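(* Let $\alpha,\beta,\gamma$ be positive irrational numbers with $\alpha+\beta+\gamma=1$, $\beta<1/2$, $\alpha<\gamma$, and suppose $1,\alpha,\beta$ are linearly independent over $\mathbb{Q}$. With $b,\widetilde{b},c,\widetilde{c}$ as in the context, the natural densities of the sets $\{n:b(n)-\widetilde{b}(n)=1\}$, $\{n:b(n)-\widetilde{b}(n)=-1\}$, $\{n:b(n)-\widetilde{b}(n)=0\}$ exist and equal $\alpha/2$, $\alpha/2$, $1-\alpha$ respectively; and the natural densities of $\{n:c(n)-\widetilde{c}(n)=1\}$, $\{n:c(n)-\widetilde{c}(n)=-1\}$, $\{n:c(n)-\widetilde{c}(n)=0\}$ exist and equal $(1/8-\alpha\beta/2)/\gamma$, $(1/8-\alpha\beta/2)/\gamma$, $(\gamma-1/4+\alpha\beta)/\gamma$ respectively.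
   Context: The natural density of $S\subseteq\mathbb{N}$ is $\lim_{N\to\infty}\frac1N\#\{n\le N:n\in S\}$. $\{x\}=x-\lfloor x\rfloor$; $u_n=\{n\alpha+1/2\}$, $v_n=\{n\beta+1/2\}$. $W_\alpha=(a(n))$, $W_\beta=(b(n))$, $W_\gamma=(c(n))$ with $a(n)=\lceil (n-1/2)/\alpha\rceil$, $b(n)=\lceil (n-1/2)/\beta\rceil$, $c(n)=\lceil (n-1/2)/\gamma\rceil$. $\widetilde{W_\beta}=\{\widetilde{b}(n):n\in\mathbb{N}\}$ where, with $m=b(n)$: $\widetilde{b}(n)=b(n)$ if $u_m>\alpha$ and $v_m<\beta$; $\widetilde{b}(n)=b(n)-1$ if $u_m<\alpha$ and $\beta/2<v_m<\beta$; $\widetilde{b}(n)=b(n)+1$ if $u_m<\alpha$ and $v_m<\beta/2$. $\widetilde{W_\gamma}=\mathbb{N}\setminus(W_\alpha\cup\widetilde{W_\beta})$, and $\widetilde{c}(n)$ is its $n$th smallest element. *)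

theory Defs
  imports "HOL-Analysis.Analysis" "HOL-Library.Infinite_Set"
begin

text \<open>
  Throughout, the natural numbers of the source are the positive integers. They are modelled by
  the type \<^typ>\<open>nat\<close>, with sequences indexed from 1; values at index 0 are never used.
\<close>

definition has_natural_density :: "nat set \<Rightarrow> real \<Rightarrow> bool" where
  "has_natural_density S d \<longleftrightarrow>
     (\<lambda>N. real (card {n \<in> S. 1 \<le> n \<and> n \<le> N}) / real N) \<longlonglongrightarrow> d"

text \<open>The \<open>n\<close>-th term of the sequence attached to the slope \<open>\<theta>\<close>. For \<open>\<theta> > 0\<close> and \<open>n \<ge> 1\<close> the
  ceiling is at least 1, so the conversion to \<^typ>\<open>nat\<close> loses nothing.\<close>

definition W_seq :: "real \<Rightarrow> nat \<Rightarrow> nat" where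
  "W_seq \<theta> n = nat \<lceil>(real n - 1 / 2) / \<theta>\<rceil>"

definition W_set :: "real \<Rightarrow> nat set" where
  "W_set \<theta> = W_seq \<theta> ` {1..}"

text \<open>The sequences \<open>u\<close> and \<open>v\<close> are the instances \<open>\<theta> = \<alpha>\<close> and \<open>\<theta> = \<beta>\<close>.\<close>

definition shifted_frac :: "real \<Rightarrow> nat \<Rightarrow> real" where
  "shifted_frac \<theta> n = frac (real n * \<theta> + 1 / 2)"

text \<open>The three cases are mutually exclusive, and they are exhaustive for \<open>n \<ge> 1\<close> when
  \<open>\<alpha>\<close> and \<open>\<beta>\<close> are positive irrationals, so the last branch is then never taken. The
  subtraction on \<^typ>\<open>nat\<close> does not truncate, because \<open>W_seq \<beta> n \<ge> 1\<close>.\<close>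

definition b_tilde :: "real \<Rightarrow> real \<Rightarrow> nat \<Rightarrow> nat" where
  "b_tilde \<alpha> \<beta> n =
     (let m = W_seq \<beta> n; u = shifted_frac \<alpha> m; v = shifted_frac \<beta> m in
      if u > \<alpha> \<and> v < \<beta> then m
      else if u < \<alpha> \<and> \<beta> / 2 < v \<and> v < \<beta> then m - 1
      else if u < \<alpha> \<and> v < \<beta> / 2 then m + 1
      else undefined)"

definition W_tilde_beta :: "real \<Rightarrow> real \<Rightarrow> nat set" where
  "W_tilde_beta \<alpha> \<beta> = b_tilde \<alpha> \<beta> ` {1..}"

definition W_tilde_gamma :: "real \<Rightarrow> real \<Rightarrow> nat set" where
  "W_tilde_gamma \<alpha> \<beta> = {1..} - (W_set \<alpha> \<union> W_tilde_beta \<alpha> \<beta>)"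

text \<open>\<^const>\<open>enumerate\<close> counts from 0.\<close>

definition c_tilde :: "real \<Rightarrow> real \<Rightarrow> nat \<Rightarrow> nat" where
  "c_tilde \<alpha> \<beta> n = enumerate (W_tilde_gamma \<alpha> \<beta>) (n - 1)"

end

theory Submission
  imports Defs "HOL-Real_Asymp.Real_Asymp"
begin

text \<open>
  Both comparisons are decided by the position of the point \<open>(u\<^sub>N, v\<^sub>N)\<close> in the unit square. Let
  \<open>A\<close>, \<open>B\<close>, \<open>C\<close> be the counting functions of the three sequences, so that \<open>C N = \<lfloor>N \<gamma> + 1/2\<rfloor>\<close>.
  Since \<open>\<alpha> + \<beta> + \<gamma> = 1\<close>, the number \<open>C N - (N - A N - B N)\<close> is \<open>1\<close> on the triangle \<open>u + v < 1/2\<close>,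
  \<open>-1\<close> on the triangle \<open>u + v > 3/2\<close>, and \<open>0\<close> in between. Passing from \<open>b\<close> to its modification
  changes \<open>B N\<close> by \<open>-1\<close> on the rectangle \<open>u < \<alpha>, v < \<beta>/2\<close> and by \<open>1\<close> on the opposite rectangle; as
  \<open>\<alpha> < \<gamma>\<close>, each rectangle lies in the corresponding triangle. Hence the counting function of the
  modified third set differs from \<open>C\<close> exactly on the two regions "triangle minus rectangle", each of
  area \<open>1/8 - \<alpha> \<beta>/2\<close>, and \<open>C\<close> jumps there, so the \<open>n\<close>-th terms differ by at most one.

  The areas become densities by equidistribution. Kronecker's theorem gives, for a box of side less
  than \<open>1/P\<close>, \<open>P\<^sup>2\<close> disjoint translates along the orbit, so its upper density is at most \<open>1/P\<^sup>2\<close>.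
  Covering a rectangle and its complement by small boxes gives the density of rectangles, and a
  staircase of rectangles gives that of the triangle.
\<close>


section \<open>Natural and upper density\<close>

definition count_upto :: "nat set \<Rightarrow> nat \<Rightarrow> nat" where
  "count_upto S N = card {n \<in> S. 1 \<le> n \<and> n \<le> N}"

text \<open>A one-sided bound is subadditive, so it can be proved by covering; the slack
  \<open>e\<close> absorbs bounded errors in the counts.\<close>

definition upper_density_le :: "nat set \<Rightarrow> real \<Rightarrow> bool" where
  "upper_density_le S d \<longleftrightarrow>
     (\<forall>e>0. \<forall>\<^sub>F N in sequentially. real (count_upto S N) \<le> (d + e) * real N)"

lemma finite_count_upto [simp]: "finite {n \<in> S. 1 \<le> n \<and> n \<le> (N::nat)}"
  by (rule finite_subset[of _ "{..N}"]) auto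

lemma has_natural_density_count_upto:
  "has_natural_density S d \<longleftrightarrow> (\<lambda>N. real (count_upto S N) / real N) \<longlonglongrightarrow> d"
  by (simp add: has_natural_density_def count_upto_def)

lemma count_upto_cong:
  "(\<And>n. n \<ge> 1 \<Longrightarrow> n \<in> S \<longleftrightarrow> n \<in> T) \<Longrightarrow> count_upto S N = count_upto T N"
  unfolding count_upto_def by (rule arg_cong[where f = card]) auto

lemma has_natural_density_cong:
  assumes "\<And>n. n \<ge> 1 \<Longrightarrow> n \<in> S \<longleftrightarrow> n \<in> T"
  shows "has_natural_density S d \<longleftrightarrow> has_natural_density T d"
  unfolding has_natural_density_count_upto using count_upto_cong[OF assms] by simp

lemma count_upto_mono: "S \<subseteq> T \<Longrightarrow> count_upto S N \<le> count_upto T N"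
  unfolding count_upto_def by (rule card_mono) auto

lemma count_upto_Un_le: "count_upto (S \<union> T) N \<le> count_upto S N + count_upto T N"
proof -
  have "{n \<in> S \<union> T. 1 \<le> n \<and> n \<le> N} = {n \<in> S. 1 \<le> n \<and> n \<le> N} \<union> {n \<in> T. 1 \<le> n \<and> n \<le> N}"
    by auto
  then show ?thesis unfolding count_upto_def by (simp only: card_Un_le)
qed

lemma count_upto_Un_disjoint:
  assumes "S \<inter> T = {}"
  shows "count_upto (S \<union> T) N = count_upto S N + count_upto T N"
proof -
  have eq: "{n \<in> S \<union> T. 1 \<le> n \<and> n \<le> N} = {n \<in> S. 1 \<le> n \<and> n \<le> N} \<union> {n \<in> T. 1 \<le> n \<and> n \<le> N}"
    by auto
  show ?thesis unfolding count_upto_def eq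
    by (rule card_Un_disjoint) (use assms in auto)
qed

lemma count_upto_UNIV: "count_upto UNIV N = N"
proof -
  have "{n::nat. 1 \<le> n \<and> n \<le> N} = {1..N}" by auto
  then show ?thesis by (simp add: count_upto_def)
qed

lemma count_upto_Compl: "real (count_upto (- S) N) = real N - real (count_upto S N)"
  using count_upto_Un_disjoint[of S "- S" N] count_upto_UNIV[of N] by simp

lemma has_natural_density_UNIV: "has_natural_density UNIV 1"
  unfolding has_natural_density_count_upto count_upto_UNIV
  by (rule tendsto_eventually) (auto intro: eventually_sequentiallyI[of 1])

lemma has_natural_density_Un:
  assumes "has_natural_density S d" "has_natural_density T e" "S \<inter> T = {}"
  shows "has_natural_density (S \<union> T) (d + e)"
  using tendsto_add[OF assms(1,2)[unfolded has_natural_density_count_upto]]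
  by (simp add: has_natural_density_count_upto count_upto_Un_disjoint[OF assms(3)] add_divide_distrib)

lemma has_natural_density_Diff:
  assumes "has_natural_density S d" "has_natural_density T e" "T \<subseteq> S"
  shows "has_natural_density (S - T) (d - e)"
proof -
  have "real (count_upto (S - T) N) = real (count_upto S N) - real (count_upto T N)" for N
    using count_upto_Un_disjoint[of T "S - T" N] assms(3) by (simp add: Un_absorb1)
  then show ?thesis
    using tendsto_diff[OF assms(1,2)[unfolded has_natural_density_count_upto]]
    by (simp add: has_natural_density_count_upto diff_divide_distrib)
qed

lemma upper_density_le_mono:
  assumes "upper_density_le T d" "S \<subseteq> T" "d \<le> e"
  shows "upper_density_le S e"
  unfolding upper_density_le_def
proof (intro allI impI)
  fix r :: real assume "r > 0"
  with assms(1) have "\<forall>\<^sub>F N in sequentially. real (count_upto T N) \<le> (d + r) * real N"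
    by (simp add: upper_density_le_def)
  then show "\<forall>\<^sub>F N in sequentially. real (count_upto S N) \<le> (e + r) * real N"
  proof eventually_elim
    case (elim N)
    have "(d + r) * real N \<le> (e + r) * real N" using assms(3) by (intro mult_right_mono) auto
    then show ?case using elim count_upto_mono[OF assms(2), of N] by linarith
  qed
qed

lemma upper_density_le_Un:
  assumes "upper_density_le S d" "upper_density_le T e"
  shows "upper_density_le (S \<union> T) (d + e)"
  unfolding upper_density_le_def
proof (intro allI impI)
  fix r :: real assume "r > 0"
  then have "r / 2 > 0" by simp
  from assms[unfolded upper_density_le_def, rule_format, OF this]
  show "\<forall>\<^sub>F N in sequentially. real (count_upto (S \<union> T) N) \<le> (d + e + r) * real N"
  proof eventually_elim
    case (elim N)
    have "(d + e + r) * real N = (d + r / 2) * real N + (e + r / 2) * real N"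
      by (simp add: algebra_simps)
    moreover have "real (count_upto (S \<union> T) N) \<le> real (count_upto S N) + real (count_upto T N)"
      using count_upto_Un_le[of S T N] by (metis of_nat_add of_nat_le_iff)
    ultimately show ?case using elim by linarith
  qed
qed

lemma upper_density_le_empty: "upper_density_le {} 0"
  by (simp add: upper_density_le_def count_upto_def)

lemma upper_density_le_UN:
  assumes "finite I" "\<And>i. i \<in> I \<Longrightarrow> upper_density_le (S i) (d i)"
  shows "upper_density_le (\<Union>i\<in>I. S i) (sum d I)"
  using assms
proof (induction I rule: finite_induct)
  case empty then show ?case by (simp add: upper_density_le_empty)
next
  case (insert i I)
  have "upper_density_le (S i) (d i)" using insert.prems by blast
  moreover have "upper_density_le (\<Union>i\<in>I. S i) (sum d I)" using insert.IH insert.prems by blast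
  ultimately have "upper_density_le (S i \<union> (\<Union>i\<in>I. S i)) (d i + sum d I)"
    by (rule upper_density_le_Un)
  then show ?case unfolding sum.insert[OF insert.hyps] UN_insert .
qed

text \<open>Lets a cover be refined: each mesh gives a bound \<open>d n\<close>, and only the limit
  of these bounds is kept.\<close>

lemma upper_density_leI_seq:
  assumes "\<And>n. upper_density_le S (d n)" "d \<longlonglongrightarrow> l"
  shows "upper_density_le S l"
  unfolding upper_density_le_def
proof (intro allI impI)
  fix r :: real assume r: "r > 0"
  then have "\<forall>\<^sub>F n in sequentially. d n < l + r / 2"
    using assms(2) by (intro order_tendstoD) auto
  then obtain n where n: "d n < l + r / 2" by (auto dest: eventually_happens)
  from r have "r / 2 > 0" by simp
  from assms(1)[unfolded upper_density_le_def, rule_format, OF this, of n]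
  show "\<forall>\<^sub>F N in sequentially. real (count_upto S N) \<le> (l + r) * real N"
  proof eventually_elim
    case (elim N)
    have "(d n + r / 2) * real N \<le> (l + r) * real N" using n by (intro mult_right_mono) auto
    then show ?case using elim by linarith
  qed
qed

text \<open>The counts of a set and of its complement add up to \<open>N\<close>, so an upper bound
  for the complement is a lower bound for the set. Equidistribution thereby reduces to covering
  arguments.\<close>

lemma has_natural_densityI_upper:
  assumes "upper_density_le S d" "upper_density_le (- S) (1 - d)"
  shows "has_natural_density S d"
  unfolding has_natural_density_count_upto
proof (rule LIMSEQ_I)
  fix r :: real assume "r > 0"
  then have "r / 2 > 0" by simp
  from assms[unfolded upper_density_le_def, rule_format, OF this]
  have "\<forall>\<^sub>F N in sequentially. norm (real (count_upto S N) / real N - d) < r"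
    using eventually_gt_at_top[of 0]
  proof eventually_elim
    case (elim N)
    then have "real (count_upto S N) / real N \<le> d + r / 2"
      "real (count_upto S N) / real N \<ge> d - r / 2"
      by (auto simp: field_simps count_upto_Compl)
    then show ?case using \<open>r > 0\<close> by (simp add: abs_if)
  qed
  then show "\<exists>no. \<forall>n\<ge>no. norm (real (count_upto S n) / real n - d) < r"
    by (simp add: eventually_sequentially)
qed

section \<open>Packing translates of a box\<close>

text \<open>Linear independence of 1, \<open>a\<close>, \<open>b\<close> over the rationals with
  denominators cleared, which is the form that Kronecker's theorem uses.\<close>

definition lin_indep_1 :: "real \<Rightarrow> real \<Rightarrow> bool" where
  "lin_indep_1 a b \<longleftrightarrow>
     (\<forall>p q r :: int. of_int p + of_int q * a + of_int r * b = 0 \<longrightarrow> p = 0 \<and> q = 0 \<and> r = 0)"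

lemma lin_indep_1_uminus: "lin_indep_1 a b \<Longrightarrow> lin_indep_1 (- a) (- b)"
  unfolding lin_indep_1_def
proof (intro allI impI)
  fix p q r :: int
  assume *: "\<forall>p q r :: int. of_int p + of_int q * a + of_int r * b = 0 \<longrightarrow> p = 0 \<and> q = 0 \<and> r = 0"
    and 0: "of_int p + of_int q * - a + of_int r * - b = 0"
  have "of_int p + of_int (- q) * a + of_int (- r) * b = 0" using 0 by simp
  with * have "p = 0 \<and> - q = 0 \<and> - r = 0" by blast
  then show "p = 0 \<and> q = 0 \<and> r = 0" by simp
qed

lemma Kronecker_two:
  fixes a b x y \<epsilon> :: real
  assumes ind: "lin_indep_1 a b" and "\<epsilon> > 0"
  obtains k m1 m2 :: int where "\<bar>of_int k * a - of_int m1 - x\<bar> < \<epsilon>" "\<bar>of_int k * b - of_int m2 - y\<bar> < \<epsilon>"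
proof -
  \<comment> \<open>\<open>Kronecker_thm_2\<close> expects the last entry of the family to be 1, so
    1 sits at index 2, behind the two slopes.\<close>
  define \<theta> where "\<theta> = (\<lambda>i::nat. if i = 0 then a else if i = 1 then b else 1)"
  define al where "al = (\<lambda>i::nat. if i = 0 then x else y)"
  have I: "p = 0 \<and> q = 0 \<and> r = 0" if "of_int p + of_int q * a + of_int r * b = 0" for p q r :: int
    using ind that unfolding lin_indep_1_def by blast
  have dist: "a \<noteq> b" "a \<noteq> 1" "b \<noteq> 1"
    using I[of 0 1 "-1"] I[of 1 "-1" 0] I[of 1 0 "-1"] by auto
  have atm: "{..2::nat} = {0,1,2}" by auto
  have im: "\<theta> ` {..2} = {a, b, 1}" unfolding atm by (auto simp: \<theta>_def)
  have inj: "inj_on \<theta> {..2}" unfolding atm using dist by (auto simp: \<theta>_def inj_on_def)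
  interpret Modules.module "(\<lambda>r x. real_of_int r * x)"
    by (simp add: Modules.module.intro distrib_left mult.commute)
  have "independent {a, b, 1}"
  proof
    assume "dependent {a, b, 1}"
    then obtain u where u: "(\<Sum>v\<in>{a,b,1}. real_of_int (u v) * v) = 0" "\<exists>v\<in>{a,b,1}. u v \<noteq> 0"
      by (auto simp: dependent_finite)
    from u(1) have "of_int (u 1) + of_int (u a) * a + of_int (u b) * b = 0"
      using dist by simp
    from I[OF this] u(2) show False by auto
  qed
  then have "independent (\<theta> ` {..2})" by (simp add: im)
  from Kronecker_thm_2[OF this inj _ \<open>\<epsilon> > 0\<close>, of al] obtain k m where
    km: "\<And>i. i < 2 \<Longrightarrow> \<bar>of_int k * \<theta> i - of_int (m i) - al i\<bar> < \<epsilon>"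
    by (auto simp: \<theta>_def)
  show thesis
    using that[of k "m 0" "m 1"] km[of 0] km[of 1] by (simp add: \<theta>_def al_def)
qed

text \<open>Two fractional parts in [0, s) differ by less than s, and the drift
  \<open>\<delta>\<close> by less than 1/P - s, so (i - j)/P is closer than 1/P to an integer.
  Multiplied by P, this makes i - j a multiple of P, hence 0. It is the disjointness of translates
  in one coordinate.\<close>

lemma frac_grid_unique:
  fixes X Y s \<delta> :: real and i j P :: nat and z :: int
  assumes "frac X < s" "frac Y < s" "X - Y = \<delta> + (real i - real j) / real P + of_int z"
    and "\<bar>\<delta>\<bar> < 1 / real P - s" "i < P" "j < P"
  shows "i = j"
proof -
  define t where "t = \<lfloor>X\<rfloor> - \<lfloor>Y\<rfloor> - z"
  have P: "real P > 0" using assms by simp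
  have "X - Y = frac X - frac Y + of_int (\<lfloor>X\<rfloor> - \<lfloor>Y\<rfloor>)" by (simp add: frac_def)
  then have "(real i - real j) / real P - of_int t = frac X - frac Y - \<delta>"
    using assms(3) by (simp add: t_def)
  moreover have "\<bar>frac X - frac Y\<bar> < s"
    using assms(1,2) frac_ge_0[of X] frac_ge_0[of Y] by linarith
  ultimately have "\<bar>(real i - real j) / real P - of_int t\<bar> < 1 / real P"
    using assms(4) by linarith
  then have "\<bar>(real i - real j) / real P - of_int t\<bar> * real P < 1"
    using P by (simp add: field_simps)
  moreover have "\<bar>(real i - real j) / real P - of_int t\<bar> * real P
      = \<bar>((real i - real j) / real P - of_int t) * real P\<bar>"
    using P by (simp add: abs_mult)
  moreover have "((real i - real j) / real P - of_int t) * real P = of_int (int i - int j - t * int P)"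
    using P by (simp add: field_simps)
  ultimately have "\<bar>real_of_int (int i - int j - t * int P)\<bar> < 1" by simp
  then have "int i - int j = t * int P" by linarith
  then have "int P dvd int i - int j" by simp
  moreover have "\<bar>int i - int j\<bar> < int P" using assms(5,6) by linarith
  ultimately show ?thesis using zdvd_imp_le[of "int P" "\<bar>int i - int j\<bar>"] by (cases "i = j") auto
qed

text \<open>Kronecker's theorem supplies \<open>P\<^sup>2\<close> pairwise disjoint translates of the box along the orbit,
  all of which are hit equally often up to a bounded error.\<close>

lemma upper_density_le_box:
  fixes a b x y s :: real
  assumes ind: "lin_indep_1 a b" and P: "P > 0" and s: "s < 1 / real P"
  shows "upper_density_le {n. frac (real n * a + x) < s \<and> frac (real n * b + y) < s} (1 / real P ^ 2)"
proof -
  define B where "B = {n. frac (real n * a + x) < s \<and> frac (real n * b + y) < s}"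
  \<comment> \<open>Half of the gap, since the difference of two Kronecker errors must stay below
    1/P - s.\<close>
  define \<epsilon> where "\<epsilon> = (1 / real P - s) / 2"
  have \<epsilon>: "\<epsilon> > 0" "2 * \<epsilon> = 1 / real P - s" using s by (auto simp: \<epsilon>_def)
  have "\<exists>k m1 m2 :: int. \<bar>of_int k * a - of_int m1 - real i / real P\<bar> < \<epsilon> \<and>
          \<bar>of_int k * b - of_int m2 - real j / real P\<bar> < \<epsilon>" for i j :: nat
    using Kronecker_two[OF ind \<epsilon>(1)] by metis
  then obtain k m1 m2 :: "nat \<Rightarrow> nat \<Rightarrow> int" where
    k1: "\<And>i j. \<bar>of_int (k i j) * a - of_int (m1 i j) - real i / real P\<bar> < \<epsilon>" and
    k2: "\<And>i j. \<bar>of_int (k i j) * b - of_int (m2 i j) - real j / real P\<bar> < \<epsilon>"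
    by metis
  define G where "G = {..<P} \<times> {..<P}"
  \<comment> \<open>\<open>K\<close> dominates every shift \<open>k i j\<close>, so adding it keeps
    the shifted times nonnegative and \<open>nat\<close> loses nothing.\<close>
  define K where "K = (\<Sum>(i, j)\<in>G. \<bar>k i j\<bar>)"
  have K: "\<bar>k i j\<bar> \<le> K" if "(i, j) \<in> G" for i j
    unfolding K_def using member_le_sum[OF that, of "\<lambda>(i, j). \<bar>k i j\<bar>"] by (simp add: G_def split_beta)
  have K0: "K \<ge> 0" unfolding K_def by (intro sum_nonneg) auto
  define F where "F = (\<lambda>(n, (i, j)). nat (int n + k i j + K))"
  have Fint: "int (F (n, (i, j))) = int n + k i j + K" if "(i, j) \<in> G" for n i j
    using K[OF that] by (simp add: F_def)
  \<comment> \<open>Injectivity of \<open>F\<close> is the disjointness of the translates: at equal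
    times the two orbit points differ by a grid vector up to small errors, and
    \<open>frac_grid_unique\<close> applies in each coordinate.\<close>
  have inj: "inj_on F (B \<times> G)"
  proof (rule inj_onI)
    fix z z' assume z: "z \<in> B \<times> G" "z' \<in> B \<times> G" and eqz: "F z = F z'"
    obtain n i j n' i' j' where zz: "z = (n, (i, j))" "z' = (n', (i', j'))"
      by (metis prod.exhaust)
    from z eqz have n: "n \<in> B" "n' \<in> B" and G: "(i, j) \<in> G" "(i', j') \<in> G"
      and eq: "F (n, (i, j)) = F (n', (i', j'))" unfolding zz by blast+
    from eq Fint[OF G(1), of n] Fint[OF G(2), of n'] have nk: "int n + k i j = int n' + k i' j'"
      by simp
    then have "real_of_int (int n + k i j) = real_of_int (int n' + k i' j')" by (rule arg_cong)
    then have nk': "real n + of_int (k i j) = real n' + of_int (k i' j')" by simp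
    have nn: "real n - real n' = of_int (k i' j') - of_int (k i j)" using nk' by linarith
    have "i' = i"
    proof (rule frac_grid_unique)
      show "frac (real n * a + x) < s" "frac (real n' * a + x) < s" using n by (auto simp: B_def)
      let ?d = "(of_int (k i' j') * a - of_int (m1 i' j') - real i' / real P)
              - (of_int (k i j) * a - of_int (m1 i j) - real i / real P)"
      have "real n * a + x - (real n' * a + x) = (real n - real n') * a" by (simp add: algebra_simps)
      also have "\<dots> = (of_int (k i' j') - of_int (k i j)) * a" by (simp add: nn)
      also have "\<dots> = ?d + (real i' - real i) / real P + of_int (m1 i' j' - m1 i j)"
        by (simp add: algebra_simps diff_divide_distrib)
      finally show "real n * a + x - (real n' * a + x) = \<dots>" .
      show "\<bar>?d\<bar> < 1 / real P - s" using k1[of i j] k1[of i' j'] \<epsilon>(2) by linarith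
    qed (use G in \<open>auto simp: G_def\<close>)
    moreover have "j' = j"
    proof (rule frac_grid_unique)
      show "frac (real n * b + y) < s" "frac (real n' * b + y) < s" using n by (auto simp: B_def)
      let ?d = "(of_int (k i' j') * b - of_int (m2 i' j') - real j' / real P)
              - (of_int (k i j) * b - of_int (m2 i j) - real j / real P)"
      have "real n * b + y - (real n' * b + y) = (real n - real n') * b" by (simp add: algebra_simps)
      also have "\<dots> = (of_int (k i' j') - of_int (k i j)) * b" by (simp add: nn)
      also have "\<dots> = ?d + (real j' - real j) / real P + of_int (m2 i' j' - m2 i j)"
        by (simp add: algebra_simps diff_divide_distrib)
      finally show "real n * b + y - (real n' * b + y) = \<dots>" .
      show "\<bar>?d\<bar> < 1 / real P - s" using k2[of i j] k2[of i' j'] \<epsilon>(2) by linarith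
    qed (use G in \<open>auto simp: G_def\<close>)
    ultimately show "z = z'" using nk by (simp add: zz)
  qed
  \<comment> \<open>The P^2 disjoint copies of the hits up to \<open>N\<close> all lie among the
    times from 0 to N + 2K.\<close>
  have bound: "P ^ 2 * count_upto B N \<le> N + 2 * nat K + 1" for N
  proof -
    let ?C = "{n \<in> B. 1 \<le> n \<and> n \<le> N}"
    have "card (?C \<times> G) = card (F ` (?C \<times> G))"
      by (rule card_image[symmetric]) (rule inj_on_subset[OF inj], auto)
    also have "\<dots> \<le> card {..N + 2 * nat K}"
    proof (rule card_mono)
      show "F ` (?C \<times> G) \<subseteq> {..N + 2 * nat K}"
      proof
        fix z assume "z \<in> F ` (?C \<times> G)"
        then obtain n i j where z: "z = F (n, (i, j))" "n \<le> N" and G: "(i, j) \<in> G" by auto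
        then show "z \<in> {..N + 2 * nat K}"
          using Fint[OF G, of n] K[OF G] by simp
      qed
    qed simp
    finally show ?thesis
      by (simp add: count_upto_def card_cartesian_product G_def power2_eq_square algebra_simps)
  qed
  show ?thesis
    unfolding upper_density_le_def
  proof (intro allI impI)
    fix e :: real assume e: "e > 0"
    \<comment> \<open>From \<open>N0\<close> on, the constant error 2K + 1 is below e N.\<close>
    obtain N0 :: nat where N0: "real N0 * e > 2 * nat K + 1" using reals_Archimedean3[OF e] by blast
    show "\<forall>\<^sub>F N in sequentially. real (count_upto {n. frac (real n * a + x) < s \<and>
            frac (real n * b + y) < s} N) \<le> (1 / real P ^ 2 + e) * real N"
    proof (rule eventually_sequentiallyI[of N0])
      fix N assume "N \<ge> N0"
      then have "real N0 * e \<le> real N * e" using e by simp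
      then have 1: "real (2 * nat K + 1) \<le> real N * e" using N0 by simp
      have "real (P ^ 2 * count_upto B N) \<le> real (N + (2 * nat K + 1))"
        using bound[of N] by (subst of_nat_le_iff) simp
      then have "real P ^ 2 * real (count_upto B N) \<le> real N + real (2 * nat K + 1)"
        by simp
      also have "\<dots> \<le> real N + real P ^ 2 * (real N * e)"
      proof -
        have "1 * (real N * e) \<le> real P ^ 2 * (real N * e)"
          using P e by (intro mult_right_mono) (auto intro!: one_le_power)
        then show ?thesis using 1 by linarith
      qed
      finally show "real (count_upto {n. frac (real n * a + x) < s \<and>
            frac (real n * b + y) < s} N) \<le> (1 / real P ^ 2 + e) * real N"
        using P unfolding B_def[symmetric] by (simp add: field_simps)
    qed
  qed
qed

section \<open>Equidistribution in rectangles and a triangle\<close>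

text \<open>Half-open sides let such boxes tile the unit square without gaps or overlaps.\<close>

definition orbit_box :: "real \<Rightarrow> real \<Rightarrow> real \<Rightarrow> real \<Rightarrow> real \<Rightarrow> real \<Rightarrow> real \<Rightarrow> real \<Rightarrow> nat set" where
  "orbit_box a x b y p q p' q' =
     {n. p \<le> frac (real n * a + x) \<and> frac (real n * a + x) < q \<and>
         p' \<le> frac (real n * b + y) \<and> frac (real n * b + y) < q'}"

lemma frac_shift:
  fixes X p :: real
  assumes "0 \<le> p" "p \<le> frac X"
  shows "frac (X - p) = frac X - p"
  unfolding frac_unique_iff
proof (intro conjI)
  show "X - p - (frac X - p) \<in> \<int>" by (simp add: frac_def)
  show "0 \<le> frac X - p" using assms by simp
  show "frac X - p < 1" using assms frac_lt_1[of X] by linarith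
qed

text \<open>Grid cells have side 1/(k + 2) but are weighted with 1/(k + 1), because
  \<open>upper_density_le_box\<close> needs a side strictly below 1/P; the mismatch vanishes in the
  limit. The maximum reflects that \<open>nat\<close> sends negative ceilings to 0.\<close>

lemma ceiling_grid_tendsto:
  fixes s :: real
  shows "(\<lambda>k. real (nat \<lceil>s * (real k + 2)\<rceil>) / (real k + 1)) \<longlonglongrightarrow> max s 0"
proof (rule tendsto_sandwich)
  show "\<forall>\<^sub>F k in sequentially. max s 0 * (real k + 2) / (real k + 1)
      \<le> real (nat \<lceil>s * (real k + 2)\<rceil>) / (real k + 1)"
  proof (intro always_eventually allI divide_right_mono)
    fix k :: nat
    show "max s 0 * (real k + 2) \<le> real (nat \<lceil>s * (real k + 2)\<rceil>)"
      by (cases "s \<ge> 0") (simp_all add: max_def)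
  qed simp
  show "\<forall>\<^sub>F k in sequentially. real (nat \<lceil>s * (real k + 2)\<rceil>) / (real k + 1)
      \<le> (max s 0 * (real k + 2) + 1) / (real k + 1)"
  proof (intro always_eventually allI divide_right_mono)
    fix k :: nat
    show "real (nat \<lceil>s * (real k + 2)\<rceil>) \<le> max s 0 * (real k + 2) + 1"
    proof (cases "s \<ge> 0")
      case True
      then have "s * (real k + 2) \<ge> 0" by simp
      then have "\<lceil>s * (real k + 2)\<rceil> \<ge> 0" by linarith
      then show ?thesis using True by simp
    next
      case False
      then have "s * (real k + 2) \<le> 0" by (intro mult_nonpos_nonneg) auto
      then show ?thesis using False by simp
    qed
  qed simp
  show "(\<lambda>k. max s 0 * (real k + 2) / (real k + 1)) \<longlonglongrightarrow> max s 0" by real_asymp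
  show "(\<lambda>k. (max s 0 * (real k + 2) + 1) / (real k + 1)) \<longlonglongrightarrow> max s 0" by real_asymp
qed

text \<open>The rectangle is covered by grid cells of side 1/(k + 2). Each becomes a corner box
  after a change of the starting point, and so has upper density at most 1/(k + 1)^2.\<close>

lemma upper_density_le_orbit_box_0:
  fixes a b x y s t :: real
  assumes ind: "lin_indep_1 a b" and st: "0 \<le> s" "0 \<le> t"
  shows "upper_density_le (orbit_box a x b y 0 s 0 t) (s * t)"
proof (rule upper_density_leI_seq)
  fix k :: nat
  define Q where "Q = real k + 2"
  have Q: "Q > 0" by (simp add: Q_def)
  define I where "I = {..<nat \<lceil>s * Q\<rceil>} \<times> {..<nat \<lceil>t * Q\<rceil>}"
  let ?B = "\<lambda>(i, j). {n. frac (real n * a + (x - real i / Q)) < 1 / Q \<and>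
                         frac (real n * b + (y - real j / Q)) < 1 / Q}"
  have cell: "\<exists>i<nat \<lceil>r * Q\<rceil>. frac (X - real i / Q) < 1 / Q" if "frac X < r" for r X
  proof -
    define i where "i = nat \<lfloor>frac X * Q\<rfloor>"
    have "0 \<le> \<lfloor>frac X * Q\<rfloor>" using Q by simp
    then have i: "real i \<le> frac X * Q" "frac X * Q < real i + 1"
      unfolding i_def by linarith+
    have "frac X * Q < r * Q" using that Q by simp
    then have "real i < r * Q" using i by linarith
    then have "i < nat \<lceil>r * Q\<rceil>" by linarith
    moreover have "frac (X - real i / Q) = frac X - real i / Q"
      by (rule frac_shift) (use i Q in \<open>auto simp: field_simps\<close>)
    then have "frac (X - real i / Q) < 1 / Q" using i Q by (simp add: field_simps)
    ultimately show ?thesis by blast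
  qed
  have "orbit_box a x b y 0 s 0 t \<subseteq> (\<Union>ij\<in>I. ?B ij)"
  proof
    fix n assume "n \<in> orbit_box a x b y 0 s 0 t"
    then have "frac (real n * a + x) < s" "frac (real n * b + y) < t" by (auto simp: orbit_box_def)
    from this[THEN cell] obtain i j where
      "i < nat \<lceil>s * Q\<rceil>" "frac (real n * a + x - real i / Q) < 1 / Q"
      "j < nat \<lceil>t * Q\<rceil>" "frac (real n * b + y - real j / Q) < 1 / Q" by blast
    then have "(i, j) \<in> I" "n \<in> ?B (i, j)" by (auto simp: I_def algebra_simps)
    then show "n \<in> (\<Union>ij\<in>I. ?B ij)" by blast
  qed
  moreover have "upper_density_le (\<Union>ij\<in>I. ?B ij) (\<Sum>ij\<in>I. 1 / real (k + 1) ^ 2)"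
  proof (rule upper_density_le_UN)
    show "finite I" by (simp add: I_def)
    fix ij assume "ij \<in> I"
    obtain i j where ij: "ij = (i, j)" by force
    have "1 / Q < 1 / real (k + 1)" by (simp add: Q_def field_simps)
    then show "upper_density_le (?B ij) (1 / real (k + 1) ^ 2)"
      unfolding ij split by (intro upper_density_le_box[OF ind]) auto
  qed
  moreover have "(\<Sum>ij\<in>I. 1 / real (k + 1) ^ 2)
     = (real (nat \<lceil>s * (real k + 2)\<rceil>) / (real k + 1)) * (real (nat \<lceil>t * (real k + 2)\<rceil>) / (real k + 1))"
    by (simp add: I_def Q_def card_cartesian_product power2_eq_square add.commute)
  ultimately show "upper_density_le (orbit_box a x b y 0 s 0 t)
     ((real (nat \<lceil>s * (real k + 2)\<rceil>) / (real k + 1)) * (real (nat \<lceil>t * (real k + 2)\<rceil>) / (real k + 1)))"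
    by - (rule upper_density_le_mono, assumption, assumption, rule eq_refl, assumption)
next
  show "(\<lambda>k. real (nat \<lceil>s * (real k + 2)\<rceil>) / (real k + 1) * (real (nat \<lceil>t * (real k + 2)\<rceil>) / (real k + 1)))
     \<longlonglongrightarrow> s * t"
    using tendsto_mult[OF ceiling_grid_tendsto[of s] ceiling_grid_tendsto[of t]] st by simp
qed

text \<open>Subtracting p and p' from the starting point moves the box to the corner; points of the
  box have coordinates at least p and p', so nothing wraps around.\<close>

lemma upper_density_le_orbit_box:
  fixes a b x y :: real
  assumes ind: "lin_indep_1 a b" and "0 \<le> p" "p \<le> q" "0 \<le> p'" "p' \<le> q'"
  shows "upper_density_le (orbit_box a x b y p q p' q') ((q - p) * (q' - p'))"
proof (rule upper_density_le_mono)
  show "upper_density_le (orbit_box a (x - p) b (y - p') 0 (q - p) 0 (q' - p')) ((q - p) * (q' - p'))"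
    by (rule upper_density_le_orbit_box_0[OF ind]) (use assms in auto)
  show "orbit_box a x b y p q p' q' \<subseteq> orbit_box a (x - p) b (y - p') 0 (q - p) 0 (q' - p')"
  proof
    fix n assume n: "n \<in> orbit_box a x b y p q p' q'"
    then have "frac (real n * a + x - p) = frac (real n * a + x) - p"
      "frac (real n * b + y - p') = frac (real n * b + y) - p'"
      using assms by (auto simp: orbit_box_def intro!: frac_shift)
    then show "n \<in> orbit_box a (x - p) b (y - p') 0 (q - p) 0 (q' - p')"
      using n by (simp add: orbit_box_def add_diff_eq)
  qed
qed simp

lemma has_natural_density_orbit_box:
  fixes a b x y :: real
  assumes ind: "lin_indep_1 a b" and "0 \<le> p" "p \<le> q" "q \<le> 1" "0 \<le> p'" "p' \<le> q'" "q' \<le> 1"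
  shows "has_natural_density (orbit_box a x b y p q p' q') ((q - p) * (q' - p'))"
proof (rule has_natural_densityI_upper)
  show "upper_density_le (orbit_box a x b y p q p' q') ((q - p) * (q' - p'))"
    by (rule upper_density_le_orbit_box) (use assms in auto)
  \<comment> \<open>The complement consists of the strips to the left and right and the pieces below
    and above. Their areas add up to one minus the area of the box, so the two upper bounds are
    complementary.\<close>
  have "upper_density_le (orbit_box a x b y 0 p 0 1 \<union> orbit_box a x b y q 1 0 1 \<union>
      (orbit_box a x b y p q 0 p' \<union> orbit_box a x b y p q q' 1))
      ((p - 0) * (1 - 0) + (1 - q) * (1 - 0) + ((q - p) * (p' - 0) + (q - p) * (1 - q')))"
    by (intro upper_density_le_Un upper_density_le_orbit_box[OF ind]) (use assms in auto)
  moreover have "- orbit_box a x b y p q p' q' \<subseteq> orbit_box a x b y 0 p 0 1 \<union> orbit_box a x b y q 1 0 1 \<union>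
      (orbit_box a x b y p q 0 p' \<union> orbit_box a x b y p q q' 1)"
    by (auto simp: orbit_box_def frac_lt_1)
  ultimately show "upper_density_le (- orbit_box a x b y p q p' q') (1 - (q - p) * (q' - p'))"
    by (rule upper_density_le_mono) (simp add: algebra_simps)
qed

text \<open>The triangle and its complement are both covered by staircases of r columns of width
  1/(2r), the complement also by the right half of the square. Each cover exceeds the true area by
  1/(8r).\<close>

lemma has_natural_density_orbit_triangle:
  fixes a b x y :: real
  assumes ind: "lin_indep_1 a b"
  shows "has_natural_density {n. frac (real n * a + x) + frac (real n * b + y) < 1 / 2} (1 / 8)"
proof (rule has_natural_densityI_upper)
  let ?u = "\<lambda>n. frac (real n * a + x)" and ?v = "\<lambda>n. frac (real n * b + y)"
  let ?T = "{n. ?u n + ?v n < 1 / 2}"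
  have gauss: "(\<Sum>i<r. real i) = real r * (real r - 1) / 2" for r :: nat
    by (induction r) (auto simp: field_simps)
  have col: "\<exists>i<2*r. real i / (2 * real r) \<le> U \<and> U < (real i + 1) / (2 * real r)"
    if "0 \<le> U" "U < 1" "r > 0" for U :: real and r :: nat
  proof -
    define i where "i = nat \<lfloor>U * (2 * real r)\<rfloor>"
    have "0 \<le> \<lfloor>U * (2 * real r)\<rfloor>" using that by simp
    then have i: "real i \<le> U * (2 * real r)" "U * (2 * real r) < real i + 1"
      unfolding i_def by linarith+
    have "U * (2 * real r) < 1 * (2 * real r)" using that by (intro mult_strict_right_mono) auto
    then have "i < 2 * r" using i by linarith
    moreover have "real i / (2 * real r) \<le> U" "U < (real i + 1) / (2 * real r)"
      using i that(3) by (auto simp: field_simps)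
    ultimately show ?thesis by blast
  qed
  show "upper_density_le ?T (1 / 8)"
  proof (rule upper_density_leI_seq)
    fix k :: nat
    define r where "r = Suc k"
    \<comment> \<open>Each column is as high as the hypotenuse over its left edge, so the staircase
      contains the triangle.\<close>
    let ?A = "\<lambda>i. orbit_box a x b y (real i / (2 * real r)) ((real i + 1) / (2 * real r)) 0
        ((real r - real i) / (2 * real r))"
    have "upper_density_le (\<Union>i\<in>{..<r}. ?A i) (\<Sum>i<r. ((real i + 1) / (2 * real r) - real i / (2 * real r))
        * ((real r - real i) / (2 * real r) - 0))"
      by (intro upper_density_le_UN upper_density_le_orbit_box[OF ind])
         (auto simp: r_def divide_simps)
    moreover have "?T \<subseteq> (\<Union>i\<in>{..<r}. ?A i)"
    proof
      fix n assume n: "n \<in> ?T"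
      obtain i where i: "real i / (2 * real r) \<le> ?u n" "?u n < (real i + 1) / (2 * real r)"
        using col[of "?u n" r] frac_lt_1[of "real n * a + x"] by (auto simp: r_def)
      have "?v n < 1 / 2 - real i / (2 * real r)" using n i by simp
      then have v: "?v n < (real r - real i) / (2 * real r)" by (simp add: r_def field_simps)
      with frac_ge_0[of "real n * b + y"] have "0 < (real r - real i) / (2 * real r)" by linarith
      then have "i < r" by (simp add: zero_less_divide_iff)
      moreover have "n \<in> ?A i" using i v by (simp add: orbit_box_def)
      ultimately show "n \<in> (\<Union>i\<in>{..<r}. ?A i)" by blast
    qed
    moreover have "(\<Sum>i<r. ((real i + 1) / (2 * real r) - real i / (2 * real r))
        * ((real r - real i) / (2 * real r) - 0)) = 1 / 8 + 1 / (8 * (real k + 1))"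
    proof -
      have "(\<Sum>i<r. ((real i + 1) / (2 * real r) - real i / (2 * real r))
        * ((real r - real i) / (2 * real r) - 0)) = (\<Sum>i<r. (real r - real i) / (2 * real r) ^ 2)"
        by (intro sum.cong refl) (simp add: r_def field_simps power2_eq_square)
      also have "\<dots> = (real r * real r - real r * (real r - 1) / 2) / (2 * real r) ^ 2"
        by (simp add: sum_subtractf gauss flip: sum_divide_distrib)
      also have "\<dots> = 1 / 8 + 1 / (8 * (real k + 1))"
        by (simp add: r_def divide_simps power2_eq_square) (simp add: algebra_simps)
      finally show ?thesis .
    qed
    ultimately show "upper_density_le ?T (1 / 8 + 1 / (8 * (real k + 1)))"
      by - (rule upper_density_le_mono, assumption, assumption, rule eq_refl, assumption)
  next
    show "(\<lambda>k. 1 / 8 + 1 / (8 * (real k + 1))) \<longlonglongrightarrow> 1 / 8" by real_asymp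
  qed
  show "upper_density_le (- ?T) (1 - 1 / 8)"
  proof (rule upper_density_leI_seq)
    fix k :: nat
    define r where "r = Suc k"
    \<comment> \<open>Now each column starts at the height of the hypotenuse over its right edge;
      \<open>?R\<close> is the half u \<ge> 1/2, which the triangle does not meet.\<close>
    let ?A = "\<lambda>i. orbit_box a x b y (real i / (2 * real r)) ((real i + 1) / (2 * real r))
        ((real r - real i - 1) / (2 * real r)) 1"
    let ?R = "orbit_box a x b y (1 / 2) 1 0 1"
    have "upper_density_le ((\<Union>i\<in>{..<r}. ?A i) \<union> ?R)
       ((\<Sum>i<r. ((real i + 1) / (2 * real r) - real i / (2 * real r))
        * (1 - (real r - real i - 1) / (2 * real r))) + (1 - 1 / 2) * (1 - 0))"
    proof (intro upper_density_le_Un upper_density_le_UN upper_density_le_orbit_box[OF ind])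
      fix i assume "i \<in> {..<r}"
      then have "real i + 1 \<le> real r" by (metis Suc_leI lessThan_iff of_nat_Suc of_nat_le_iff add.commute)
      then show "0 \<le> (real r - real i - 1) / (2 * real r)" "(real r - real i - 1) / (2 * real r) \<le> 1"
        by (auto simp: divide_simps)
    qed (auto simp: r_def divide_simps)
    moreover have "- ?T \<subseteq> (\<Union>i\<in>{..<r}. ?A i) \<union> ?R"
    proof
      fix n assume n: "n \<in> - ?T"
      show "n \<in> (\<Union>i\<in>{..<r}. ?A i) \<union> ?R"
      proof (cases "?u n < 1 / 2")
        case False
        then show ?thesis by (simp add: orbit_box_def frac_lt_1)
      next
        case True
        obtain i where i: "real i / (2 * real r) \<le> ?u n" "?u n < (real i + 1) / (2 * real r)"
          using col[of "?u n" r] frac_lt_1[of "real n * a + x"] by (auto simp: r_def)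
        have "1 / 2 - (real i + 1) / (2 * real r) \<le> ?v n" using n i by simp
        then have v: "(real r - real i - 1) / (2 * real r) \<le> ?v n" by (simp add: r_def field_simps)
        have "real i / (2 * real r) < 1 / 2" using i True by linarith
        then have "i < r" by (simp add: r_def divide_simps)
        moreover have "n \<in> ?A i" using i v by (simp add: orbit_box_def frac_lt_1)
        ultimately show ?thesis by blast
      qed
    qed
    moreover have "(\<Sum>i<r. ((real i + 1) / (2 * real r) - real i / (2 * real r))
        * (1 - (real r - real i - 1) / (2 * real r))) + (1 - 1 / 2) * (1 - 0)
      = 1 - 1 / 8 + 1 / (8 * (real k + 1))"
    proof -
      have "(\<Sum>i<r. ((real i + 1) / (2 * real r) - real i / (2 * real r))
        * (1 - (real r - real i - 1) / (2 * real r))) = (\<Sum>i<r. (real r + 1 + real i) / (2 * real r) ^ 2)"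
        by (intro sum.cong refl) (simp add: r_def field_simps power2_eq_square)
      also have "\<dots> = (real r * (real r + 1) + real r * (real r - 1) / 2) / (2 * real r) ^ 2"
        by (simp add: sum.distrib gauss distrib_left flip: sum_divide_distrib)
      also have "\<dots> = 3 / 8 + 1 / (8 * (real k + 1))"
        by (simp add: r_def divide_simps power2_eq_square) (simp add: algebra_simps)
      finally show ?thesis by simp
    qed
    ultimately show "upper_density_le (- ?T) (1 - 1 / 8 + 1 / (8 * (real k + 1)))"
      by - (rule upper_density_le_mono, assumption, assumption, rule eq_refl, assumption)
  next
    show "(\<lambda>k. 1 - 1 / 8 + 1 / (8 * (real k + 1))) \<longlonglongrightarrow> 1 - 1 / (8::real)" by real_asymp
  qed
qed

section \<open>The sequences of slope \<open>\<theta>\<close>\<close>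

text \<open>The counting function of the sequence of slope \<open>\<theta>\<close> in closed form,
  as \<open>W_seq_le_iff\<close> justifies.\<close>

definition W_count :: "real \<Rightarrow> nat \<Rightarrow> int" where
  "W_count \<theta> N = \<lfloor>real N * \<theta> + 1 / 2\<rfloor>"

text \<open>Both sides amount to n - 1/2 \<le> N \<theta>. Questions about terms become questions
  about floors; the modified sequences receive the same kind of criterion.\<close>

lemma W_seq_le_iff:
  assumes "\<theta> > 0"
  shows "W_seq \<theta> n \<le> N \<longleftrightarrow> int n \<le> W_count \<theta> N"
proof -
  have "W_seq \<theta> n \<le> N \<longleftrightarrow> (real n - 1 / 2) / \<theta> \<le> real N"
    by (simp add: W_seq_def nat_le_iff ceiling_le_iff)
  also have "\<dots> \<longleftrightarrow> real n \<le> real N * \<theta> + 1 / 2" using assms by (simp add: field_simps)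
  also have "\<dots> \<longleftrightarrow> int n \<le> W_count \<theta> N" by (simp add: W_count_def le_floor_iff)
  finally show ?thesis .
qed

lemma W_count_0 [simp]: "W_count \<theta> 0 = 0"
  by (simp add: W_count_def)

lemma W_count_nonneg: "\<theta> > 0 \<Longrightarrow> W_count \<theta> N \<ge> 0"
  by (simp add: W_count_def)

lemma W_seq_ge_1: "\<theta> > 0 \<Longrightarrow> n \<ge> 1 \<Longrightarrow> W_seq \<theta> n \<ge> 1"
  using W_seq_le_iff[of \<theta> n 0] by simp

lemma shifted_frac_eq: "shifted_frac \<theta> N = real N * \<theta> + 1 / 2 - of_int (W_count \<theta> N)"
  by (simp add: shifted_frac_def W_count_def frac_def)

lemma shifted_frac_bounds: "0 \<le> shifted_frac \<theta> N" "shifted_frac \<theta> N < 1"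
  by (simp_all add: shifted_frac_def frac_lt_1)

lemma W_count_Suc:
  assumes "0 < \<theta>" "\<theta> < 1"
  shows "W_count \<theta> (Suc N) = W_count \<theta> N + (if shifted_frac \<theta> N < 1 - \<theta> then 0 else 1)"
  unfolding W_count_def[of \<theta> "Suc N"]
  by (rule floor_unique)
     (use assms shifted_frac_bounds[of \<theta> N] shifted_frac_eq[of \<theta> N] in \<open>auto simp: algebra_simps\<close>)

lemma shifted_frac_Suc:
  assumes "0 < \<theta>" "\<theta> < 1"
  shows "shifted_frac \<theta> (Suc N) = shifted_frac \<theta> N + \<theta> - (if shifted_frac \<theta> N < 1 - \<theta> then 0 else 1)"
  unfolding shifted_frac_eq[of \<theta> "Suc N"] W_count_Suc[OF assms]
  by (simp add: shifted_frac_eq algebra_simps)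

text \<open>Rotation by \<open>\<theta>\<close> carries [1 - \<theta>, 1) onto [0, \<theta>), so a
  jump can also be read off at the point of arrival.\<close>

lemma W_count_Suc':
  assumes "0 < \<theta>" "\<theta> < 1"
  shows "W_count \<theta> (Suc N) = W_count \<theta> N + (if shifted_frac \<theta> (Suc N) < \<theta> then 1 else 0)"
  using shifted_frac_bounds[of \<theta> N]
  by (simp add: W_count_Suc[OF assms] shifted_frac_Suc[OF assms])

lemma W_seq_eq_Suc_iff:
  assumes "\<theta> > 0"
  shows "W_seq \<theta> n = Suc N \<longleftrightarrow> W_count \<theta> N < int n \<and> int n \<le> W_count \<theta> (Suc N)"
  using W_seq_le_iff[OF assms, of n N] W_seq_le_iff[OF assms, of n "Suc N"] by linarith

lemma W_seq_shifted_frac: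
  assumes "0 < \<theta>" "\<theta> < 1" "n \<ge> 1"
  shows "shifted_frac \<theta> (W_seq \<theta> n) < \<theta>"
proof -
  obtain N where N: "W_seq \<theta> n = Suc N" using W_seq_ge_1[OF assms(1,3)] by (cases "W_seq \<theta> n") auto
  then show ?thesis using W_seq_eq_Suc_iff[OF assms(1), of n N] W_count_Suc'[OF assms(1,2), of N]
    by (auto split: if_splits)
qed

text \<open>The terms are exactly the places where the counting function jumps, and a jump shows in
  the fractional part.\<close>

lemma mem_W_set_iff:
  assumes "0 < \<theta>" "\<theta> < 1"
  shows "m \<in> W_set \<theta> \<longleftrightarrow> m \<ge> 1 \<and> shifted_frac \<theta> m < \<theta>"
proof
  assume "m \<in> W_set \<theta>"
  then show "m \<ge> 1 \<and> shifted_frac \<theta> m < \<theta>"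
    using W_seq_ge_1 W_seq_shifted_frac assms by (auto simp: W_set_def)
next
  assume m: "m \<ge> 1 \<and> shifted_frac \<theta> m < \<theta>"
  then obtain N where N: "m = Suc N" by (cases m) auto
  define n where "n = nat (W_count \<theta> m)"
  have "W_count \<theta> m = W_count \<theta> N + 1" using W_count_Suc'[OF assms, of N] m N by simp
  then have n: "int n = W_count \<theta> N + 1" "int n = W_count \<theta> m" "n \<ge> 1"
    using W_count_nonneg[OF assms(1), of N] by (auto simp: n_def)
  then have "W_seq \<theta> n = m" using W_seq_eq_Suc_iff[OF assms(1), of n N] N by simp
  then show "m \<in> W_set \<theta>" using n by (auto simp: W_set_def)
qed

text \<open>The counting function grows by at most one per step, which leaves no room for a repeated
  value or a reversal.\<close>

lemma strict_mono_W_seq: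
  assumes "0 < \<theta>" "\<theta> < 1"
  shows "strict_mono_on {1..} (W_seq \<theta>)"
proof (rule strict_mono_onI, rule ccontr)
  fix n n' assume n: "n \<in> {1..}" "n < n'" "\<not> W_seq \<theta> n < W_seq \<theta> n'"
  obtain N where N: "W_seq \<theta> n = Suc N"
    using W_seq_ge_1[OF assms(1), of n] n by (cases "W_seq \<theta> n") auto
  then have "int n' \<le> W_count \<theta> (Suc N)" using n W_seq_le_iff[OF assms(1), of n' "Suc N"] by simp
  moreover have "W_count \<theta> N < int n" using W_seq_eq_Suc_iff[OF assms(1)] N by simp
  ultimately show False using W_count_Suc[OF assms, of N] n by (simp split: if_splits)
qed

lemma W_seq_at_top:
  assumes "0 < \<theta>" "\<theta> < 1"
  shows "filterlim (W_seq \<theta>) at_top sequentially"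
proof (rule filterlim_at_top_mono[OF filterlim_ident], rule eventually_sequentiallyI[of 0])
  fix n :: nat
  have "W_count \<theta> N \<le> int N" for N
    by (induction N) (auto simp: W_count_Suc[OF assms])
  from this[of "W_seq \<theta> n"] show "n \<le> W_seq \<theta> n" using W_seq_le_iff[OF assms(1), of n "W_seq \<theta> n"] by simp
qed

lemma W_seq_ratio:
  assumes "0 < \<theta>" "\<theta> < 1"
  shows "(\<lambda>n. real (W_seq \<theta> n) / real n) \<longlonglongrightarrow> 1 / \<theta>"
proof (rule tendsto_sandwich)
  have W: "(real n - 1 / 2) / \<theta> \<le> real (W_seq \<theta> n) \<and> real (W_seq \<theta> n) \<le> (real n - 1 / 2) / \<theta> + 1"
    if "n \<ge> 1" for n
  proof -
    have "(real n - 1 / 2) / \<theta> \<ge> 0" using that assms by simp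
    then have "\<lceil>(real n - 1 / 2) / \<theta>\<rceil> \<ge> 0" by linarith
    then show ?thesis unfolding W_seq_def by simp
  qed
  show "\<forall>\<^sub>F n in sequentially. ((real n - 1 / 2) / \<theta>) / real n \<le> real (W_seq \<theta> n) / real n"
    by (rule eventually_sequentiallyI[of 1]) (intro divide_right_mono, use W in auto)
  show "\<forall>\<^sub>F n in sequentially. real (W_seq \<theta> n) / real n \<le> ((real n - 1 / 2) / \<theta> + 1) / real n"
    by (rule eventually_sequentiallyI[of 1]) (intro divide_right_mono, use W in auto)
  show "(\<lambda>n. ((real n - 1 / 2) / \<theta>) / real n) \<longlonglongrightarrow> 1 / \<theta>"
    using assms unfolding inverse_eq_divide[symmetric] by real_asymp
  show "(\<lambda>n. ((real n - 1 / 2) / \<theta> + 1) / real n) \<longlonglongrightarrow> 1 / \<theta>"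
    using assms unfolding inverse_eq_divide[symmetric] by real_asymp
qed

text \<open>Indices up to K correspond to elements of \<open>X\<close> up to
  \<open>W_seq \<theta> K\<close>, which is asymptotic to K / \<theta>. This is the source of the
  divisions by \<beta> and \<gamma> in the final densities.\<close>

lemma has_natural_density_W_seq:
  assumes \<theta>: "0 < \<theta>" "\<theta> < 1" and X: "X \<subseteq> W_set \<theta>" "has_natural_density X d"
  shows "has_natural_density {n. n \<ge> 1 \<and> W_seq \<theta> n \<in> X} (d / \<theta>)"
proof -
  let ?Y = "{n. n \<ge> 1 \<and> W_seq \<theta> n \<in> X}"
  note mono = strict_mono_W_seq[OF \<theta>]
  have count: "count_upto ?Y K = count_upto X (W_seq \<theta> K)" if "K \<ge> 1" for K
  proof -
    have "bij_betw (W_seq \<theta>) {n \<in> ?Y. 1 \<le> n \<and> n \<le> K} {x \<in> X. 1 \<le> x \<and> x \<le> W_seq \<theta> K}"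
      unfolding bij_betw_def
    proof
      show "inj_on (W_seq \<theta>) {n \<in> ?Y. 1 \<le> n \<and> n \<le> K}"
        by (rule inj_on_subset[OF strict_mono_on_imp_inj_on[OF mono]]) auto
      have le: "W_seq \<theta> n \<le> W_seq \<theta> K \<longleftrightarrow> n \<le> K" if "n \<ge> 1" for n
        using strict_mono_on_less_eq[OF mono, of n K] that \<open>K \<ge> 1\<close> by simp
      show "W_seq \<theta> ` {n \<in> ?Y. 1 \<le> n \<and> n \<le> K} = {x \<in> X. 1 \<le> x \<and> x \<le> W_seq \<theta> K}"
      proof (intro equalityI subsetI)
        fix x assume "x \<in> W_seq \<theta> ` {n \<in> ?Y. 1 \<le> n \<and> n \<le> K}"
        then show "x \<in> {x \<in> X. 1 \<le> x \<and> x \<le> W_seq \<theta> K}"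
          using le W_seq_ge_1[OF \<theta>(1)] by auto
      next
        fix x assume x: "x \<in> {x \<in> X. 1 \<le> x \<and> x \<le> W_seq \<theta> K}"
        with X(1) obtain n where "n \<ge> 1" "x = W_seq \<theta> n" by (auto simp: W_set_def)
        with x le show "x \<in> W_seq \<theta> ` {n \<in> ?Y. 1 \<le> n \<and> n \<le> K}" by auto
      qed
    qed
    then show ?thesis unfolding count_upto_def by (rule bij_betw_same_card)
  qed
  have "(\<lambda>K. real (count_upto X (W_seq \<theta> K)) / real (W_seq \<theta> K)) \<longlonglongrightarrow> d"
    using filterlim_compose[OF X(2)[unfolded has_natural_density_count_upto] W_seq_at_top[OF \<theta>]] .
  from tendsto_mult[OF this W_seq_ratio[OF \<theta>]]
  have "(\<lambda>K. real (count_upto X (W_seq \<theta> K)) / real (W_seq \<theta> K) * (real (W_seq \<theta> K) / real K)) \<longlonglongrightarrow> d / \<theta>"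
    by simp
  then show ?thesis
    unfolding has_natural_density_count_upto
  proof (rule Lim_transform_eventually)
    show "\<forall>\<^sub>F K in sequentially. real (count_upto X (W_seq \<theta> K)) / real (W_seq \<theta> K) *
        (real (W_seq \<theta> K) / real K) = real (count_upto ?Y K) / real K"
    proof (rule eventually_sequentiallyI[of 1])
      fix K :: nat assume K: "1 \<le> K"
      then have "real (W_seq \<theta> K) \<noteq> 0" using W_seq_ge_1[OF \<theta>(1) K] by simp
      then show "real (count_upto X (W_seq \<theta> K)) / real (W_seq \<theta> K) *
        (real (W_seq \<theta> K) / real K) = real (count_upto ?Y K) / real K"
        using count[OF K] by simp
    qed
  qed
qed

section \<open>Shifts, images and enumerations of sets\<close>

lemma has_natural_density_image_Suc:
  assumes "has_natural_density S d" "0 \<notin> S"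
  shows "has_natural_density (Suc ` S) d"
proof -
  have count: "count_upto (Suc ` S) (Suc N) = count_upto S N" for N
  proof -
    have "{n \<in> Suc ` S. 1 \<le> n \<and> n \<le> Suc N} = Suc ` {n \<in> S. 1 \<le> n \<and> n \<le> N}"
      using assms(2) by (auto simp: Suc_le_eq intro: gr0I)
    then show ?thesis by (simp add: count_upto_def card_image)
  qed
  have "(\<lambda>N. real (count_upto S N) / real N * (real N / (real N + 1))) \<longlonglongrightarrow> d * 1"
    by (intro tendsto_mult assms(1)[unfolded has_natural_density_count_upto]) real_asymp
  then have "(\<lambda>N. real (count_upto S N) / real N * (real N / (real N + 1))) \<longlonglongrightarrow> d" by simp
  then have "(\<lambda>N. real (count_upto (Suc ` S) (Suc N)) / real (Suc N)) \<longlonglongrightarrow> d"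
  proof (rule Lim_transform_eventually)
    show "\<forall>\<^sub>F N in sequentially. real (count_upto S N) / real N * (real N / (real N + 1))
        = real (count_upto (Suc ` S) (Suc N)) / real (Suc N)"
      by (rule eventually_sequentiallyI[of 1]) (simp add: count add.commute)
  qed
  then show ?thesis unfolding has_natural_density_count_upto
    by (rule LIMSEQ_imp_Suc)
qed

lemma count_upto_image:
  assumes inj: "inj_on f {1..}" and pos: "\<And>n. n \<ge> 1 \<Longrightarrow> f n \<ge> 1"
    and le: "\<And>n. n \<ge> 1 \<Longrightarrow> f n \<le> N \<longleftrightarrow> int n \<le> g"
  shows "count_upto (f ` {1..}) N = nat g"
proof -
  have "{m \<in> f ` {1..}. 1 \<le> m \<and> m \<le> N} = f ` {1..nat g}"
    using pos le by (auto simp: image_iff)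
  moreover have "inj_on f {1..nat g}" by (rule inj_on_subset[OF inj]) auto
  ultimately show ?thesis by (simp add: count_upto_def card_image)
qed

text \<open>The counterpart of \<open>W_seq_le_iff\<close> for a set listed in increasing order; the
  listing starts at index 0, hence the strict inequality.\<close>

lemma enumerate_le_iff:
  fixes S :: "nat set"
  assumes inf: "infinite S" and "0 \<notin> S"
  shows "enumerate S k \<le> N \<longleftrightarrow> k < count_upto S N"
proof -
  define A where "A = {k. enumerate S k \<le> N}"
  have "A \<subseteq> {..N}" using le_enumerate[OF inf] by (auto simp: A_def intro: le_trans)
  then have fin: "finite A" by (rule finite_subset) simp
  have "{n \<in> S. 1 \<le> n \<and> n \<le> N} = enumerate S ` A"
  proof (intro equalityI subsetI)
    fix n assume "n \<in> {n \<in> S. 1 \<le> n \<and> n \<le> N}"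
    then show "n \<in> enumerate S ` A" using enumerate_Ex[OF inf, of n] by (auto simp: A_def)
  next
    fix n assume "n \<in> enumerate S ` A"
    then have "n \<in> S" "n \<le> N" using enumerate_in_set[OF inf] by (auto simp: A_def)
    then show "n \<in> {n \<in> S. 1 \<le> n \<and> n \<le> N}" using assms(2) by (cases n) auto
  qed
  moreover have "inj_on (enumerate S) A" by (rule inj_on_subset[OF inj_enumerate[OF inf]]) simp
  ultimately have card: "count_upto S N = card A" by (simp add: count_upto_def card_image)
  show ?thesis
  proof
    assume "enumerate S k \<le> N"
    have "{..k} \<subseteq> A"
    proof
      fix j assume "j \<in> {..k}"
      then have "enumerate S j \<le> enumerate S k" using enumerate_mono_le_iff[OF inf] by simp
      then show "j \<in> A" using \<open>enumerate S k \<le> N\<close> by (simp add: A_def)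
    qed
    from card_mono[OF fin this] show "k < count_upto S N" by (simp add: card)
  next
    assume k: "k < count_upto S N"
    show "enumerate S k \<le> N"
    proof (rule ccontr)
      assume *: "\<not> enumerate S k \<le> N"
      have "A \<subseteq> {..<k}"
      proof
        fix j assume "j \<in> A"
        then have "enumerate S j < enumerate S k" using * by (simp add: A_def)
        then show "j \<in> {..<k}" using enumerate_mono_iff[OF inf] by simp
      qed
      from card_mono[OF _ this] k show False by (simp add: card)
    qed
  qed
qed

text \<open>Serves to keep the orbit off the lines that bound the regions below.\<close>

lemma irrational_affine_not_Ints:
  assumes "\<theta> \<notin> \<rat>" "k \<in> \<rat>" "k \<noteq> 0" "c \<in> \<rat>"
  shows "k * \<theta> + c \<notin> \<int>"
proof
  assume "k * \<theta> + c \<in> \<int>"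
  then have "k * \<theta> + c \<in> \<rat>" using Ints_subset_Rats by blast
  then have "(k * \<theta> + c - c) / k \<in> \<rat>" using assms by (intro Rats_divide Rats_diff)
  then show False using assms by simp
qed

section \<open>Three slopes with sum one\<close>

locale three_slopes =
  fixes \<alpha> \<beta> \<gamma> :: real
  assumes pos: "\<alpha> > 0" "\<beta> > 0" "\<gamma> > 0"
    and irr: "\<alpha> \<notin> \<rat>" "\<beta> \<notin> \<rat>" "\<gamma> \<notin> \<rat>"
    and sum1: "\<alpha> + \<beta> + \<gamma> = 1"
    and \<beta>_less: "\<beta> < 1 / 2"
    and \<alpha>_less: "\<alpha> < \<gamma>"
begin

abbreviation u :: "nat \<Rightarrow> real" where "u \<equiv> shifted_frac \<alpha>"
abbreviation v :: "nat \<Rightarrow> real" where "v \<equiv> shifted_frac \<beta>"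
abbreviation A :: "nat \<Rightarrow> int" where "A \<equiv> W_count \<alpha>"
abbreviation B :: "nat \<Rightarrow> int" where "B \<equiv> W_count \<beta>"
abbreviation C :: "nat \<Rightarrow> int" where "C \<equiv> W_count \<gamma>"

definition low_rect :: "nat set" where
  "low_rect = {N. u N < \<alpha> \<and> v N < \<beta> / 2}"

text \<open>The orbit point one step before a term that is moved down, whereas
  \<open>low_rect\<close> is the position of a raised term itself. The two rectangles are exchanged
  by a half-turn of the square, up to boundary.\<close>

definition high_rect :: "nat set" where
  "high_rect = {N. u N > 1 - \<alpha> \<and> v N > 1 - \<beta> / 2}"

definition low_triangle :: "nat set" where
  "low_triangle = {N. u N + v N < 1 / 2}"

definition high_triangle :: "nat set" where
  "high_triangle = {N. u N + v N > 3 / 2}"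

text \<open>The last bound is \<alpha> < \<gamma> in the form 2\<alpha> + \<beta> < \<alpha> +
  \<beta> + \<gamma> = 1. It puts the corner (\<alpha>, \<beta>/2) inside the low triangle.\<close>

lemma bounds: "\<alpha> < 1" "\<beta> < 1" "\<gamma> < 1" "\<alpha> < 1 / 2" "\<alpha> + \<beta> / 2 < 1 / 2"
  using pos sum1 \<beta>_less \<alpha>_less by auto

lemmas B_Suc = W_count_Suc'[OF pos(2) bounds(2)]
lemmas C_Suc = W_count_Suc[OF pos(3) bounds(3)]
lemmas u_Suc = shifted_frac_Suc[OF pos(1) bounds(1)]
lemmas v_Suc = shifted_frac_Suc[OF pos(2) bounds(2)]
lemmas u_bounds = shifted_frac_bounds[of \<alpha>]
lemmas v_bounds = shifted_frac_bounds[of \<beta>]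

lemma u_0: "u 0 = 1 / 2" and v_0: "v 0 = 1 / 2"
  by (simp_all add: shifted_frac_eq)

lemma u_neq:
  assumes "c \<in> \<int>" "N \<ge> 1"
  shows "u N \<noteq> c"
proof
  assume "u N = c"
  then have "real N * \<alpha> + (1 / 2 - c - of_int (A N)) = 0" by (simp add: shifted_frac_eq)
  then have "real N * \<alpha> + (1 / 2 - c - of_int (A N)) \<in> \<int>" by simp
  moreover have "c \<in> \<rat>" using assms(1) Ints_subset_Rats by blast
  ultimately show False
    using irrational_affine_not_Ints[OF irr(1), of "real N" "1 / 2 - c - of_int (A N)"] assms(2) by simp
qed

text \<open>Hitting \<alpha> would require an integer value of \<open>u\<close> one step earlier,
  which irrationality forbids; at the start that value is 1/2.\<close>

lemma u_neq_\<alpha>: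
  assumes "m \<ge> 1"
  shows "u m \<noteq> \<alpha>"
proof -
  obtain N where N: "m = Suc N" using assms by (cases m) auto
  show ?thesis
  proof (cases "N = 0")
    case True
    then show ?thesis using N u_Suc[of 0] u_0 bounds by simp
  next
    case False
    then show ?thesis using N u_Suc[of N] u_neq[of 0 N] u_neq[of 1 N] by (auto split: if_splits)
  qed
qed

lemma v_neq_half: "v m \<noteq> \<beta> / 2"
proof
  assume "v m = \<beta> / 2"
  then have "(real m - 1 / 2) * \<beta> + (1 / 2 - of_int (B m)) = 0"
    by (simp add: shifted_frac_eq algebra_simps)
  then have "(real m - 1 / 2) * \<beta> + (1 / 2 - of_int (B m)) \<in> \<int>" by simp
  moreover have "real m - 1 / 2 \<noteq> 0"
  proof
    assume "real m - 1 / 2 = 0"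
    then have "real (2 * m) = real 1" by simp
    then have "2 * m = 1" by (simp only: of_nat_eq_iff)
    then show False by presburger
  qed
  ultimately show False
    using irrational_affine_not_Ints[OF irr(2), of "real m - 1 / 2" "1 / 2 - of_int (B m)"] by simp
qed

text \<open>Modulo 1 the sum u + v equals -N \<gamma>, which is irrational for N \<ge> 1. The value
  1 is left out because it is attained at N = 0.\<close>

lemma uv_sum_neq:
  assumes "2 * c \<in> \<int>" "c \<noteq> 1"
  shows "u N + v N \<noteq> c"
proof
  assume *: "u N + v N = c"
  then have "N \<noteq> 0" using assms u_0 v_0 by (auto intro: ccontr)
  have sum: "\<alpha> + \<beta> = 1 - \<gamma>" using sum1 by simp
  have "real N * (\<alpha> + \<beta>) + 1 - of_int (A N) - of_int (B N) - c = 0"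
    using * by (simp add: shifted_frac_eq algebra_simps)
  then have "- real N * \<gamma> + (real N + 1 - of_int (A N) - of_int (B N) - c) = 0"
    unfolding sum by (simp add: algebra_simps)
  then have "- real N * \<gamma> + (real N + 1 - of_int (A N) - of_int (B N) - c) \<in> \<int>" by simp
  moreover have "c \<in> \<rat>"
  proof -
    have "2 * c \<in> \<rat>" using assms(1) Ints_subset_Rats by blast
    then have "2 * c / 2 \<in> \<rat>" by (intro Rats_divide) auto
    then show ?thesis by simp
  qed
  ultimately show False
    using irrational_affine_not_Ints[OF irr(3), of "- real N" "real N + 1 - of_int (A N) - of_int (B N) - c"]
      \<open>N \<noteq> 0\<close> by simp
qed

lemma low_rect_subset: "low_rect \<subseteq> low_triangle"
  using bounds by (auto simp: low_rect_def low_triangle_def)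

lemma high_rect_subset: "high_rect \<subseteq> high_triangle"
  using bounds by (auto simp: high_rect_def high_triangle_def)

section \<open>The modified second sequence and its counting function\<close>

lemma b_tilde_eq:
  assumes "n \<ge> 1"
  shows "b_tilde \<alpha> \<beta> n =
    (let m = W_seq \<beta> n in
     if u m > \<alpha> then m else if v m > \<beta> / 2 then m - 1 else m + 1)"
proof -
  define m where "m = W_seq \<beta> n"
  have "m \<ge> 1" unfolding m_def by (rule W_seq_ge_1[OF pos(2) assms])
  moreover have "v m < \<beta>" unfolding m_def by (rule W_seq_shifted_frac[OF pos(2) bounds(2) assms])
  \<comment> \<open>A term has v < \<beta>, and neither boundary value is attained, so the
    \<open>undefined\<close> branch is never reached.\<close>
  ultimately show ?thesis
    using u_neq_\<alpha>[of m] v_neq_half[of m]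
    unfolding b_tilde_def m_def[symmetric] Let_def by auto
qed

text \<open>One rotation step carries the top right corner of the square to the bottom left one; the
  edge u = 1 - \<alpha> is excluded because it would be carried to 0.\<close>

lemma high_rect_iff:
  assumes "v (Suc N) < \<beta>"
  shows "N \<in> high_rect \<longleftrightarrow> u (Suc N) < \<alpha> \<and> v (Suc N) > \<beta> / 2"
proof -
  have v: "v N \<ge> 1 - \<beta>" using assms v_Suc[of N] v_bounds[of N] by (auto split: if_splits)
  have "u N \<noteq> 1 - \<alpha>"
  proof
    assume "u N = 1 - \<alpha>"
    then have "u (Suc N) = 0" using u_Suc[of N] by simp
    then show False using u_neq[of 0 "Suc N"] by simp
  qed
  then have "u (Suc N) < \<alpha> \<longleftrightarrow> u N > 1 - \<alpha>" using u_Suc[of N] u_bounds[of N] by auto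
  moreover have "v (Suc N) > \<beta> / 2 \<longleftrightarrow> v N > 1 - \<beta> / 2" using v_Suc[of N] v by auto
  ultimately show ?thesis by (simp add: high_rect_def)
qed

lemma high_rect_v: "N \<in> high_rect \<Longrightarrow> v (Suc N) < \<beta>"
  using v_Suc[of N] v_bounds[of N] pos by (auto simp: high_rect_def)

lemma low_high_rect_disjoint: "N \<in> low_rect \<Longrightarrow> N \<notin> high_rect"
  using bounds by (auto simp: low_rect_def high_rect_def)

text \<open>Terms move by at most one, so only two can cross the threshold \<open>N\<close>: a term
  at \<open>N\<close> that is raised and a term at \<open>Suc N\<close> that is lowered.\<close>

lemma b_tilde_le_iff:
  assumes n: "n \<ge> 1"
  shows "b_tilde \<alpha> \<beta> n \<le> N \<longleftrightarrow>
    W_seq \<beta> n \<le> N \<and> \<not> (N \<in> low_rect \<and> W_seq \<beta> n = N) \<or> N \<in> high_rect \<and> W_seq \<beta> n = Suc N"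
proof -
  define m where "m = W_seq \<beta> n"
  have m1: "m \<ge> 1" unfolding m_def by (rule W_seq_ge_1[OF pos(2) n])
  have vm: "v m < \<beta>" unfolding m_def by (rule W_seq_shifted_frac[OF pos(2) bounds(2) n])
  have b: "b_tilde \<alpha> \<beta> n = (if u m > \<alpha> then m else if v m > \<beta> / 2 then m - 1 else m + 1)"
    using b_tilde_eq[OF n] by (simp add: m_def Let_def)
  note ne = u_neq_\<alpha>[OF m1] v_neq_half[of m]
  consider "m < N" | "m = N" | "m = Suc N" | "m > Suc N" by linarith
  then show ?thesis
  proof cases
    case 2
    then show ?thesis unfolding m_def[symmetric] using b ne m1 low_high_rect_disjoint[of N] by (auto simp: low_rect_def)
  next
    case 3
    then show ?thesis unfolding m_def[symmetric] using b ne high_rect_iff[of N] vm by auto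
  qed (use b in \<open>auto simp: m_def[symmetric]\<close>)
qed

definition B_tilde :: "nat \<Rightarrow> int" where
  "B_tilde N = B N + (if N \<in> high_rect then 1 else 0) - (if N \<in> low_rect then 1 else 0)"

lemma B_Suc_low_rect:
  assumes "Suc N \<in> low_rect"
  shows "B (Suc N) = B N + 1"
  using assms B_Suc[of N] pos by (auto simp: low_rect_def)

lemma zero_notin_rect: "0 \<notin> low_rect" "0 \<notin> high_rect"
  using u_0 bounds by (auto simp: low_rect_def high_rect_def)

lemma b_tilde_le_iff_count:
  assumes n: "n \<ge> 1"
  shows "b_tilde \<alpha> \<beta> n \<le> N \<longleftrightarrow> int n \<le> B_tilde N"
proof -
  have 1: "W_seq \<beta> n \<le> N \<longleftrightarrow> int n \<le> B N" by (rule W_seq_le_iff[OF pos(2)])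
  have 2: "W_seq \<beta> n = Suc N \<longleftrightarrow> int n = B N + 1" if "N \<in> high_rect"
    using W_seq_eq_Suc_iff[OF pos(2), of n N] B_Suc[of N] high_rect_v[OF that] by auto
  have 3: "W_seq \<beta> n = N \<longleftrightarrow> int n = B N" if "N \<in> low_rect"
  proof -
    have "N \<noteq> 0" using that zero_notin_rect(1) by (intro notI) simp
    then obtain M where M: "N = Suc M" using not0_implies_Suc by blast
    then show ?thesis
      using W_seq_eq_Suc_iff[OF pos(2), of n M] B_Suc_low_rect[of M] that by auto
  qed
  show ?thesis unfolding b_tilde_le_iff[OF n] B_tilde_def
    using 1 2 3 low_high_rect_disjoint[of N] by auto
qed

text \<open>Three events can each contribute one to the increment: a jump of \<open>B\<close>,
  arrival in \<open>high_rect\<close>, departure from \<open>low_rect\<close>. They exclude each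
  other pairwise because \<beta> < 1/2.\<close>

lemma B_tilde_Suc: "B_tilde (Suc N) \<le> B_tilde N + 1"
proof -
  have 1: "\<not> (v (Suc N) < \<beta> \<and> Suc N \<in> high_rect)"
    using bounds \<beta>_less by (auto simp: high_rect_def)
  have 2: "\<not> (v (Suc N) < \<beta> \<and> N \<in> low_rect)"
    using v_Suc[of N] v_bounds[of N] \<beta>_less pos by (auto simp: low_rect_def)
  have 3: "\<not> (Suc N \<in> high_rect \<and> N \<in> low_rect)"
    using v_Suc[of N] v_bounds[of N] \<beta>_less pos by (auto simp: low_rect_def high_rect_def)
  show ?thesis using 1 2 3 B_Suc[of N] unfolding B_tilde_def by auto
qed

lemma b_tilde_ge_1:
  assumes "n \<ge> 1"
  shows "b_tilde \<alpha> \<beta> n \<ge> 1"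
  using b_tilde_le_iff_count[OF assms, of 0] assms zero_notin_rect by (auto simp: B_tilde_def)

lemma inj_on_b_tilde: "inj_on (b_tilde \<alpha> \<beta>) {1..}"
proof (rule linorder_inj_onI)
  fix n n' :: nat assume n: "n < n'" "n \<in> {1..}" "n' \<in> {1..}"
  show "b_tilde \<alpha> \<beta> n \<noteq> b_tilde \<alpha> \<beta> n'"
  proof
    assume eq: "b_tilde \<alpha> \<beta> n = b_tilde \<alpha> \<beta> n'"
    obtain N where N: "b_tilde \<alpha> \<beta> n = Suc N" using b_tilde_ge_1[of n] n by (cases "b_tilde \<alpha> \<beta> n") auto
    have "int n' \<le> B_tilde (Suc N)" using b_tilde_le_iff_count[of n' "Suc N"] n N eq by simp
    moreover have "int n > B_tilde N" using b_tilde_le_iff_count[of n N] n N by simp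
    ultimately show False using B_tilde_Suc[of N] n by simp
  qed
qed auto

lemma B_tilde_nonneg: "B_tilde N \<ge> 0"
proof (cases "N \<in> low_rect")
  case True
  then have "N \<noteq> 0" using zero_notin_rect(1) by (intro notI) simp
  then obtain M where M: "N = Suc M" using not0_implies_Suc by blast
  then show ?thesis using True B_Suc_low_rect[of M] W_count_nonneg[OF pos(2), of M] by (simp add: B_tilde_def)
next
  case False
  then show ?thesis using W_count_nonneg[OF pos(2), of N] by (simp add: B_tilde_def)
qed

text \<open>The purpose of the modification: a term is moved exactly when it collides with the first
  sequence, and since \<alpha> < 1/2 neither neighbour of a collision belongs to that
  sequence.\<close>

lemma W_set_disjoint: "W_set \<alpha> \<inter> W_tilde_beta \<alpha> \<beta> = {}"
proof -
  have "\<not> u (b_tilde \<alpha> \<beta> n) < \<alpha>" if n: "n \<ge> 1" for n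
  proof -
    define m where "m = W_seq \<beta> n"
    have m1: "m \<ge> 1" unfolding m_def by (rule W_seq_ge_1[OF pos(2) n])
    then obtain N where N: "m = Suc N" by (cases m) auto
    have b: "b_tilde \<alpha> \<beta> n = (if u m > \<alpha> then m else if v m > \<beta> / 2 then m - 1 else m + 1)"
      using b_tilde_eq[OF n] by (simp add: m_def Let_def)
    have 1: "\<not> u N < \<alpha>" if "u m < \<alpha>" using that u_Suc[of N] u_bounds[of N] bounds N by (auto split: if_splits)
    have 2: "\<not> u (Suc m) < \<alpha>" if "u m < \<alpha>" using that u_Suc[of m] u_bounds[of m] bounds by (auto split: if_splits)
    show ?thesis using b 1 2 N u_neq_\<alpha>[OF m1] by auto
  qed
  then show ?thesis using mem_W_set_iff[OF pos(1) bounds(1)] by (auto simp: W_tilde_beta_def)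
qed

section \<open>The modified third sequence and its counting function\<close>

lemma count_W_tilde_gamma: "int (count_upto (W_tilde_gamma \<alpha> \<beta>) N) = int N - A N - B_tilde N"
proof -
  have "count_upto (W_set \<alpha>) N = nat (A N)" unfolding W_set_def
    by (rule count_upto_image[OF strict_mono_on_imp_inj_on[OF strict_mono_W_seq[OF pos(1) bounds(1)]]])
       (use W_seq_ge_1[OF pos(1)] W_seq_le_iff[OF pos(1)] in auto)
  moreover have "count_upto (W_tilde_beta \<alpha> \<beta>) N = nat (B_tilde N)" unfolding W_tilde_beta_def
    by (rule count_upto_image[OF inj_on_b_tilde]) (use b_tilde_ge_1 b_tilde_le_iff_count in auto)
  ultimately have "count_upto (W_set \<alpha> \<union> W_tilde_beta \<alpha> \<beta>) N = nat (A N) + nat (B_tilde N)"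
    using count_upto_Un_disjoint[OF W_set_disjoint] by simp
  then have "real (count_upto (- (W_set \<alpha> \<union> W_tilde_beta \<alpha> \<beta>)) N) = real N - real (nat (A N) + nat (B_tilde N))"
    by (simp only: count_upto_Compl)
  moreover have "count_upto (W_tilde_gamma \<alpha> \<beta>) N = count_upto (- (W_set \<alpha> \<union> W_tilde_beta \<alpha> \<beta>)) N"
    by (rule count_upto_cong) (auto simp: W_tilde_gamma_def)
  ultimately have "real (count_upto (W_tilde_gamma \<alpha> \<beta>) N) = real N - real (nat (A N) + nat (B_tilde N))"
    by simp
  then show ?thesis using B_tilde_nonneg[of N] W_count_nonneg[OF pos(1), of N] by linarith
qed

text \<open>N \<gamma> + 1/2 is the integer N - A - B plus 3/2 - u - v, and the floor of the latter
  is 1, 0 or -1 according to the triangles.\<close>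

lemma C_eq:
  "C N = int N - A N - B N + (if N \<in> low_triangle then 1 else 0) - (if N \<in> high_triangle then 1 else 0)"
proof -
  have \<gamma>: "\<gamma> = 1 - \<alpha> - \<beta>" using sum1 by simp
  have "real N * \<gamma> = real N - real N * \<alpha> - real N * \<beta>" unfolding \<gamma> by (simp add: algebra_simps)
  then have "real N * \<gamma> + 1 / 2 = of_int (int N - A N - B N) + (3 / 2 - u N - v N)"
    by (simp add: shifted_frac_eq)
  then show ?thesis
    unfolding W_count_def[of \<gamma>] low_triangle_def high_triangle_def
    using u_bounds[of N] v_bounds[of N] uv_sum_neq[of "1 / 2" N] uv_sum_neq[of "3 / 2" N]
    by (auto intro!: floor_unique)
qed

text \<open>The places where \<open>C\<close> is one ahead of the count of the modified third set;
  on \<open>C_deficit\<close> it is one behind.\<close>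

definition C_excess :: "nat set" where "C_excess = low_triangle - low_rect"
definition C_deficit :: "nat set" where "C_deficit = high_triangle - high_rect"

definition C_tilde :: "nat \<Rightarrow> int" where
  "C_tilde N = C N - (if N \<in> C_excess then 1 else 0) + (if N \<in> C_deficit then 1 else 0)"

lemma count_W_tilde_gamma': "int (count_upto (W_tilde_gamma \<alpha> \<beta>) N) = C_tilde N"
proof -
  have "\<not> (N \<in> low_triangle \<and> N \<in> high_triangle)" by (auto simp: low_triangle_def high_triangle_def)
  then show ?thesis
    unfolding count_W_tilde_gamma B_tilde_def C_tilde_def C_eq C_excess_def C_deficit_def
    using low_rect_subset high_rect_subset by auto
qed

lemma infinite_W_tilde_gamma: "infinite (W_tilde_gamma \<alpha> \<beta>)"
proof
  assume fin: "finite (W_tilde_gamma \<alpha> \<beta>)"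
  obtain N :: nat where N: "real N * \<gamma> > real (card (W_tilde_gamma \<alpha> \<beta>)) + 2"
    using reals_Archimedean3[OF pos(3)] by blast
  have "count_upto (W_tilde_gamma \<alpha> \<beta>) N \<le> card (W_tilde_gamma \<alpha> \<beta>)"
    unfolding count_upto_def by (rule card_mono[OF fin]) auto
  then have "C_tilde N \<le> int (card (W_tilde_gamma \<alpha> \<beta>))" by (simp flip: count_W_tilde_gamma')
  moreover have "C_tilde N \<ge> C N - 1" by (simp add: C_tilde_def)
  moreover have "C N \<ge> int (card (W_tilde_gamma \<alpha> \<beta>)) + 2"
    using N by (simp add: W_count_def le_floor_iff)
  ultimately show False by simp
qed

lemma c_tilde_le_iff:
  assumes "n \<ge> 1"
  shows "c_tilde \<alpha> \<beta> n \<le> N \<longleftrightarrow> int n \<le> C_tilde N"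
proof -
  have "0 \<notin> W_tilde_gamma \<alpha> \<beta>" by (simp add: W_tilde_gamma_def)
  from enumerate_le_iff[OF infinite_W_tilde_gamma this, of "n - 1" N]
  have "c_tilde \<alpha> \<beta> n \<le> N \<longleftrightarrow> n - 1 < count_upto (W_tilde_gamma \<alpha> \<beta>) N"
    by (simp add: c_tilde_def)
  also have "\<dots> \<longleftrightarrow> int n \<le> C_tilde N" using assms unfolding count_W_tilde_gamma'[symmetric] by linarith
  finally show ?thesis .
qed

lemma C_Suc_deficit:
  assumes "N \<in> C_deficit"
  shows "C (Suc N) = C N + 1"
proof -
  have "\<not> shifted_frac \<gamma> N < 1 - \<gamma>"
  proof -
    have hi: "u N + v N > 3 / 2" and le: "u N \<le> 1 - \<alpha> \<or> v N \<le> 1 - \<beta> / 2"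
      using assms by (auto simp: C_deficit_def high_triangle_def high_rect_def)
    have "C N = int N - A N - B N - 1" using hi by (simp add: C_eq low_triangle_def high_triangle_def)
    then have "shifted_frac \<gamma> N = real N * (\<alpha> + \<beta> + \<gamma>) + 5 / 2 - real N - u N - v N"
      by (simp add: shifted_frac_eq algebra_simps)
    then have "shifted_frac \<gamma> N = 5 / 2 - u N - v N" by (simp add: sum1)
    then show ?thesis using le u_bounds[of N] v_bounds[of N] sum1 bounds \<beta>_less by auto
  qed
  then show ?thesis by (simp add: C_Suc)
qed

text \<open>The mirror image of \<open>C_Suc_deficit\<close>, read at the point of arrival: the
  fractional part is 1/2 - u - v and lies below \<gamma>.\<close>

lemma C_excess_Suc:
  assumes "Suc N \<in> C_excess"
  shows "C (Suc N) = C N + 1"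
proof -
  have "shifted_frac \<gamma> (Suc N) < \<gamma>"
  proof -
    have lo: "u (Suc N) + v (Suc N) < 1 / 2" and ge: "u (Suc N) \<ge> \<alpha> \<or> v (Suc N) \<ge> \<beta> / 2"
      using assms by (auto simp: C_excess_def low_triangle_def low_rect_def)
    have "C (Suc N) = int (Suc N) - A (Suc N) - B (Suc N) + 1"
      using lo by (simp add: C_eq low_triangle_def high_triangle_def)
    then have "shifted_frac \<gamma> (Suc N) = real (Suc N) * (\<alpha> + \<beta> + \<gamma>) + 1 / 2 - real (Suc N) - u (Suc N) - v (Suc N)"
      by (simp add: shifted_frac_eq algebra_simps)
    then have "shifted_frac \<gamma> (Suc N) = 1 / 2 - u (Suc N) - v (Suc N)" by (simp add: sum1)
    then show ?thesis using ge u_bounds[of "Suc N"] v_bounds[of "Suc N"] sum1 bounds \<beta>_less by auto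
  qed
  then show ?thesis by (simp add: W_count_Suc'[OF pos(3) bounds(3)])
qed

lemma zero_notin_triangle: "0 \<notin> C_excess" "0 \<notin> C_deficit"
  using u_0 v_0 by (auto simp: C_excess_def C_deficit_def low_triangle_def high_triangle_def)

text \<open>\<open>C\<close> reaches n at the term \<open>Suc M\<close>. A deficit at
  \<open>M\<close> lets the modified count reach n one step early, an excess at \<open>Suc M\<close>
  delays it by one step. Larger displacements would need a deficit not followed by a jump of
  \<open>C\<close>, or an excess not reached by one.\<close>

lemma c_tilde_diff:
  assumes n: "n \<ge> 1"
  shows "int (W_seq \<gamma> n) - int (c_tilde \<alpha> \<beta> n) \<in> {-1, 0, 1} \<and>
    (int (W_seq \<gamma> n) - int (c_tilde \<alpha> \<beta> n) = 1 \<longleftrightarrow> W_seq \<gamma> n \<in> Suc ` C_deficit) \<and>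
    (int (W_seq \<gamma> n) - int (c_tilde \<alpha> \<beta> n) = -1 \<longleftrightarrow> W_seq \<gamma> n \<in> C_excess)"
proof -
  obtain M where M: "W_seq \<gamma> n = Suc M" using W_seq_ge_1[OF pos(3) n] by (cases "W_seq \<gamma> n") auto
  have CM: "C M < int n" "int n \<le> C (Suc M)"
    using W_seq_eq_Suc_iff[OF pos(3), of n M] M by auto
  moreover have step: "C (Suc N) \<le> C N + 1" "C N \<le> C (Suc N)" for N by (auto simp: C_Suc)
  ultimately have CM': "C M = int n - 1" "C (Suc M) = int n" using step[of M] by linarith+
  note le = c_tilde_le_iff[OF n]
  have ex: "\<not> (N \<in> C_excess \<and> N \<in> C_deficit)" for N
    by (auto simp: C_excess_def C_deficit_def low_triangle_def high_triangle_def)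
  have a: "c_tilde \<alpha> \<beta> n \<le> M \<longleftrightarrow> M \<in> C_deficit"
    unfolding le C_tilde_def using CM' ex[of M] by auto
  \<comment> \<open>Being two steps early would need a deficit at \<open>K\<close> with
    \<open>C\<close> constant from \<open>K\<close> to \<open>M\<close>.\<close>
  have b: "\<not> c_tilde \<alpha> \<beta> n \<le> K" if K: "M = Suc K" for K
  proof
    assume "c_tilde \<alpha> \<beta> n \<le> K"
    then have "int n \<le> C K + (if K \<in> C_deficit then 1 else 0)" unfolding le C_tilde_def
      by (auto split: if_splits)
    moreover have "C K \<le> C M" using step[of K] K by simp
    ultimately have "K \<in> C_deficit" "C K = C M" using CM' by (auto split: if_splits)
    then show False using C_Suc_deficit[of K] K by simp
  qed
  have b0: "c_tilde \<alpha> \<beta> n \<ge> 1" using le[of 0] n zero_notin_triangle by (simp add: C_tilde_def)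
  have c: "c_tilde \<alpha> \<beta> n \<le> Suc M \<longleftrightarrow> Suc M \<notin> C_excess"
    unfolding le C_tilde_def using CM' ex[of "Suc M"] by auto
  \<comment> \<open>Being two steps late would need an excess at \<open>Suc (Suc M)\<close> at which
    \<open>C\<close> does not jump.\<close>
  have d: "c_tilde \<alpha> \<beta> n \<le> Suc (Suc M)"
  proof (rule ccontr)
    assume "\<not> ?thesis"
    then have "int n > C (Suc (Suc M)) - (if Suc (Suc M) \<in> C_excess then 1 else 0)"
      unfolding le C_tilde_def by (auto split: if_splits)
    then have "Suc (Suc M) \<in> C_excess" "C (Suc (Suc M)) = C (Suc M)"
      using step[of "Suc M"] CM' by (auto split: if_splits)
    then show False using C_excess_Suc[of "Suc M"] by simp
  qed
  have e: "c_tilde \<alpha> \<beta> n \<ge> M" using b b0 by (cases M) (auto simp: not_le)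
  have "Suc M \<in> Suc ` C_deficit \<longleftrightarrow> c_tilde \<alpha> \<beta> n \<le> M" using a by auto
  moreover have "Suc M \<in> C_excess \<longleftrightarrow> \<not> c_tilde \<alpha> \<beta> n \<le> Suc M" using c by blast
  ultimately show ?thesis using d e by (simp only: M) auto
qed

section \<open>Differences as orbit positions and densities of the regions\<close>

lemma b_tilde_diff:
  assumes n: "n \<ge> 1"
  shows "int (W_seq \<beta> n) - int (b_tilde \<alpha> \<beta> n) =
    (let m = W_seq \<beta> n in if u m < \<alpha> then if v m > \<beta> / 2 then 1 else -1 else 0)"
proof -
  have "W_seq \<beta> n \<ge> 1" by (rule W_seq_ge_1[OF pos(2) n])
  then show ?thesis using u_neq_\<alpha>[of "W_seq \<beta> n"]
    by (auto simp: b_tilde_eq[OF n] Let_def of_nat_diff)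
qed

lemma has_natural_density_low_rect:
  assumes ind: "lin_indep_1 \<alpha> \<beta>"
  shows "has_natural_density low_rect (\<alpha> * \<beta> / 2)"
proof -
  have "low_rect = orbit_box \<alpha> (1 / 2) \<beta> (1 / 2) 0 \<alpha> 0 (\<beta> / 2)"
    by (simp add: low_rect_def orbit_box_def shifted_frac_def)
  then show ?thesis
    using has_natural_density_orbit_box[OF ind, of 0 \<alpha> 0 "\<beta> / 2" "1 / 2" "1 / 2"] pos bounds by simp
qed

text \<open>These are the lowered terms, located at the term itself rather than one step before as
  in \<open>high_rect\<close>.\<close>

lemma has_natural_density_upper_half_rect:
  assumes ind: "lin_indep_1 \<alpha> \<beta>"
  shows "has_natural_density {N. u N < \<alpha> \<and> \<beta> / 2 < v N \<and> v N < \<beta>} (\<alpha> * \<beta> / 2)"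
proof -
  have "{N. u N < \<alpha> \<and> \<beta> / 2 < v N \<and> v N < \<beta>} = orbit_box \<alpha> (1 / 2) \<beta> (1 / 2) 0 \<alpha> (\<beta> / 2) \<beta>"
  proof -
    have "\<beta> / 2 < v N \<longleftrightarrow> \<beta> / 2 \<le> v N" for N using v_neq_half[of N] by linarith
    then show ?thesis by (simp add: orbit_box_def shifted_frac_def)
  qed
  then show ?thesis
    using has_natural_density_orbit_box[OF ind, of 0 \<alpha> "\<beta> / 2" \<beta> "1 / 2" "1 / 2"] pos bounds by simp
qed

lemma has_natural_density_low_triangle:
  assumes ind: "lin_indep_1 \<alpha> \<beta>"
  shows "has_natural_density low_triangle (1 / 8)"
  using has_natural_density_orbit_triangle[OF ind, of "1 / 2" "1 / 2"]
  by (simp add: low_triangle_def shifted_frac_def)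

text \<open>The reflection \<open>(u, v) \<mapsto> (1 - u, 1 - v)\<close> turns the high sets into low ones for the slopes
  \<open>- \<alpha>\<close> and \<open>- \<beta>\<close>.\<close>

lemma frac_reflect:
  assumes "\<theta> \<notin> \<rat>" "N \<ge> 1"
  shows "frac (real N * - \<theta> + - (1 / 2)) = 1 - shifted_frac \<theta> N"
proof -
  have "real N * \<theta> + 1 / 2 \<notin> \<int>"
    using irrational_affine_not_Ints[OF assms(1), of "real N" "1 / 2"] assms(2) by simp
  then have "frac (- (real N * \<theta> + 1 / 2)) = 1 - shifted_frac \<theta> N"
    by (simp only: frac_neg shifted_frac_def if_False)
  then show ?thesis by simp
qed

lemma has_natural_density_high_rect:
  assumes ind: "lin_indep_1 \<alpha> \<beta>"
  shows "has_natural_density high_rect (\<alpha> * \<beta> / 2)"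
proof -
  have "has_natural_density (orbit_box (- \<alpha>) (- (1 / 2)) (- \<beta>) (- (1 / 2)) 0 \<alpha> 0 (\<beta> / 2)) (\<alpha> * \<beta> / 2)"
    using has_natural_density_orbit_box[OF lin_indep_1_uminus[OF ind], of 0 \<alpha> 0 "\<beta> / 2" "- (1 / 2)" "- (1 / 2)"]
      pos bounds by simp
  moreover have "n \<in> high_rect \<longleftrightarrow> n \<in> orbit_box (- \<alpha>) (- (1 / 2)) (- \<beta>) (- (1 / 2)) 0 \<alpha> 0 (\<beta> / 2)" if "n \<ge> 1" for n
    unfolding high_rect_def orbit_box_def mem_Collect_eq frac_reflect[OF irr(1) that] frac_reflect[OF irr(2) that]
    using u_bounds[of n] v_bounds[of n] by auto
  ultimately show ?thesis using has_natural_density_cong by blast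
qed

lemma has_natural_density_high_triangle:
  assumes ind: "lin_indep_1 \<alpha> \<beta>"
  shows "has_natural_density high_triangle (1 / 8)"
proof -
  let ?T = "{n. frac (real n * - \<alpha> + - (1 / 2)) + frac (real n * - \<beta> + - (1 / 2)) < 1 / 2}"
  have "has_natural_density ?T (1 / 8)"
    by (rule has_natural_density_orbit_triangle[OF lin_indep_1_uminus[OF ind]])
  moreover have "n \<in> high_triangle \<longleftrightarrow> n \<in> ?T" if "n \<ge> 1" for n
    unfolding high_triangle_def mem_Collect_eq frac_reflect[OF irr(1) that] frac_reflect[OF irr(2) that]
    by auto
  ultimately show ?thesis using has_natural_density_cong by blast
qed

end

section \<open>Assembly of the six densities\<close>

lemma has_natural_density_int_trichotomy:
  fixes f :: "nat \<Rightarrow> int"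
  assumes 1: "has_natural_density {n. n \<ge> 1 \<and> f n = 1} d"
    and 2: "has_natural_density {n. n \<ge> 1 \<and> f n = -1} e"
    and f: "\<And>n. n \<ge> 1 \<Longrightarrow> f n \<in> {-1, 0, 1}"
  shows "has_natural_density {n. n \<ge> 1 \<and> f n = 0} (1 - d - e)"
proof -
  have "has_natural_density (UNIV - ({n. n \<ge> 1 \<and> f n = 1} \<union> {n. n \<ge> 1 \<and> f n = -1})) (1 - (d + e))"
    by (intro has_natural_density_Diff has_natural_density_UNIV has_natural_density_Un 1 2) auto
  moreover have "n \<in> {n. n \<ge> 1 \<and> f n = 0} \<longleftrightarrow>
      n \<in> UNIV - ({n. n \<ge> 1 \<and> f n = 1} \<union> {n. n \<ge> 1 \<and> f n = -1})" if "n \<ge> 1" for n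
    using f[OF that] that by auto
  ultimately have "has_natural_density {n. n \<ge> 1 \<and> f n = 0} (1 - (d + e))"
    using has_natural_density_cong by blast
  then show ?thesis by (simp add: diff_diff_eq)
qed

lemma lin_indep_1_if_independent:
  fixes \<alpha> \<beta> :: real
  assumes dist: "distinct [1, \<alpha>, \<beta>]"
    and ind: "module.independent (\<lambda>(q::rat) (x::real). of_rat q * x) {1, \<alpha>, \<beta>}"
  shows "lin_indep_1 \<alpha> \<beta>"
  unfolding lin_indep_1_def
proof (intro allI impI)
  fix p q r :: int
  assume 0: "of_int p + of_int q * \<alpha> + of_int r * \<beta> = 0"
  interpret Modules.module "(\<lambda>(q::rat) (x::real). of_rat q * x)"
    by unfold_locales (auto simp: algebra_simps of_rat_add of_rat_mult)
  \<comment> \<open>Integer relations become rational coefficients on a three-element set;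
    distinctness of its elements lets \<open>c\<close> return the intended coefficient at
    each.\<close>
  define c where "c = (\<lambda>x. if x = 1 then rat_of_int p else if x = \<alpha> then of_int q else of_int r)"
  have "(\<Sum>x\<in>{1, \<alpha>, \<beta>}. of_rat (c x) * x) = 0" using dist 0 by (simp add: c_def add.assoc)
  then have "c x = 0" if "x \<in> {1, \<alpha>, \<beta>}" for x
    using independentD[OF ind _ subset_refl, of c x] that by simp
  from this[of 1] this[of \<alpha>] this[of \<beta>] show "p = 0 \<and> q = 0 \<and> r = 0" using dist by (simp add: c_def)
qed

theorem theorem7:
  fixes \<alpha> \<beta> \<gamma> :: real
  assumes "\<alpha> > 0" "\<beta> > 0" "\<gamma> > 0"
    and "\<alpha> \<notin> \<rat>" "\<beta> \<notin> \<rat>" "\<gamma> \<notin> \<rat>"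
    and "\<alpha> + \<beta> + \<gamma> = 1"
    and "\<beta> < 1 / 2"
    and "\<alpha> < \<gamma>"
    and "distinct [1, \<alpha>, \<beta>]"
    and "module.independent (\<lambda>(q::rat) (x::real). of_rat q * x) {1, \<alpha>, \<beta>}"
  shows
    "has_natural_density {n. n \<ge> 1 \<and> int (W_seq \<beta> n) - int (b_tilde \<alpha> \<beta> n) = 1} (\<alpha> / 2) \<and>
     has_natural_density {n. n \<ge> 1 \<and> int (W_seq \<beta> n) - int (b_tilde \<alpha> \<beta> n) = -1} (\<alpha> / 2) \<and>
     has_natural_density {n. n \<ge> 1 \<and> int (W_seq \<beta> n) - int (b_tilde \<alpha> \<beta> n) = 0} (1 - \<alpha>) \<and>
     has_natural_density {n. n \<ge> 1 \<and> int (W_seq \<gamma> n) - int (c_tilde \<alpha> \<beta> n) = 1}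
       ((1 / 8 - \<alpha> * \<beta> / 2) / \<gamma>) \<and>
     has_natural_density {n. n \<ge> 1 \<and> int (W_seq \<gamma> n) - int (c_tilde \<alpha> \<beta> n) = -1}
       ((1 / 8 - \<alpha> * \<beta> / 2) / \<gamma>) \<and>
     has_natural_density {n. n \<ge> 1 \<and> int (W_seq \<gamma> n) - int (c_tilde \<alpha> \<beta> n) = 0}
       ((\<gamma> - 1 / 4 + \<alpha> * \<beta>) / \<gamma>)"
proof -
  interpret three_slopes \<alpha> \<beta> \<gamma> using assms by unfold_locales auto
  have ind: "lin_indep_1 \<alpha> \<beta>" by (rule lin_indep_1_if_independent) (use assms in auto)
  let ?b = "\<lambda>n. int (W_seq \<beta> n) - int (b_tilde \<alpha> \<beta> n)"
  let ?c = "\<lambda>n. int (W_seq \<gamma> n) - int (c_tilde \<alpha> \<beta> n)"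
  note \<beta> = pos(2) bounds(2) and \<gamma> = pos(3) bounds(3)
  let ?hi = "{N. u N < \<alpha> \<and> \<beta> / 2 < v N \<and> v N < \<beta>}"
  \<comment> \<open>The orbit starts at u = 1/2 > \<alpha>, so index 0 does not satisfy the
    condition.\<close>
  have pos_mem: "N \<ge> 1" if "u N < \<alpha>" for N using that u_0 bounds by (cases N) auto

  have "{n. n \<ge> 1 \<and> ?b n = 1} = {n. n \<ge> 1 \<and> W_seq \<beta> n \<in> ?hi}"
    using b_tilde_diff W_seq_shifted_frac[OF \<beta>] by (auto simp: Let_def split: if_splits)
  moreover have "?hi \<subseteq> W_set \<beta>" using mem_W_set_iff[OF \<beta>] pos_mem by auto
  ultimately have b1: "has_natural_density {n. n \<ge> 1 \<and> ?b n = 1} (\<alpha> / 2)"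
    using has_natural_density_W_seq[OF \<beta> _ has_natural_density_upper_half_rect[OF ind]] pos by simp

  have "v (W_seq \<beta> n) < \<beta> / 2 \<longleftrightarrow> \<not> \<beta> / 2 < v (W_seq \<beta> n)" for n
    using v_neq_half[of "W_seq \<beta> n"] by linarith
  then have "{n. n \<ge> 1 \<and> ?b n = -1} = {n. n \<ge> 1 \<and> W_seq \<beta> n \<in> low_rect}"
    using b_tilde_diff by (auto simp: low_rect_def Let_def split: if_splits)
  moreover have "low_rect \<subseteq> W_set \<beta>" using mem_W_set_iff[OF \<beta>] pos_mem pos by (force simp: low_rect_def)
  ultimately have b2: "has_natural_density {n. n \<ge> 1 \<and> ?b n = -1} (\<alpha> / 2)"
    using has_natural_density_W_seq[OF \<beta> _ has_natural_density_low_rect[OF ind]] pos by simp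

  have "has_natural_density {n. n \<ge> 1 \<and> ?b n = 0} (1 - \<alpha> / 2 - \<alpha> / 2)"
    by (rule has_natural_density_int_trichotomy[OF b1 b2]) (simp add: b_tilde_diff Let_def)
  then have b3: "has_natural_density {n. n \<ge> 1 \<and> ?b n = 0} (1 - \<alpha>)" by simp

  have deficit: "has_natural_density C_deficit (1 / 8 - \<alpha> * \<beta> / 2)"
    unfolding C_deficit_def
    by (intro has_natural_density_Diff has_natural_density_high_triangle has_natural_density_high_rect
        ind high_rect_subset)
  have excess: "has_natural_density C_excess (1 / 8 - \<alpha> * \<beta> / 2)"
    unfolding C_excess_def
    by (intro has_natural_density_Diff has_natural_density_low_triangle has_natural_density_low_rect
        ind low_rect_subset)
  have jump: "Suc N \<in> W_set \<gamma>" if "C (Suc N) = C N + 1" for N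
    using that W_count_Suc'[OF \<gamma>, of N] mem_W_set_iff[OF \<gamma>] by (auto split: if_splits)

  \<comment> \<open>A deficit at \<open>N\<close> concerns the term at \<open>Suc N\<close>, hence
    the shifted set; the shift leaves the density unchanged.\<close>
  have "{n. n \<ge> 1 \<and> ?c n = 1} = {n. n \<ge> 1 \<and> W_seq \<gamma> n \<in> Suc ` C_deficit}"
    using c_tilde_diff by blast
  moreover have "Suc ` C_deficit \<subseteq> W_set \<gamma>" using jump C_Suc_deficit by blast
  ultimately have c1: "has_natural_density {n. n \<ge> 1 \<and> ?c n = 1} ((1 / 8 - \<alpha> * \<beta> / 2) / \<gamma>)"
    using has_natural_density_W_seq[OF \<gamma> _ has_natural_density_image_Suc[OF deficit zero_notin_triangle(2)]]
    by simp

  have "{n. n \<ge> 1 \<and> ?c n = -1} = {n. n \<ge> 1 \<and> W_seq \<gamma> n \<in> C_excess}"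
    using c_tilde_diff by blast
  moreover have "C_excess \<subseteq> W_set \<gamma>"
  proof
    fix M assume M: "M \<in> C_excess"
    then have "M \<noteq> 0" using zero_notin_triangle(1) by (intro notI) simp
    then obtain N where "M = Suc N" using not0_implies_Suc by blast
    then show "M \<in> W_set \<gamma>" using jump C_excess_Suc M by blast
  qed
  ultimately have c2: "has_natural_density {n. n \<ge> 1 \<and> ?c n = -1} ((1 / 8 - \<alpha> * \<beta> / 2) / \<gamma>)"
    using has_natural_density_W_seq[OF \<gamma> _ excess] by simp

  have "has_natural_density {n. n \<ge> 1 \<and> ?c n = 0}
      (1 - (1 / 8 - \<alpha> * \<beta> / 2) / \<gamma> - (1 / 8 - \<alpha> * \<beta> / 2) / \<gamma>)"
    by (rule has_natural_density_int_trichotomy[OF c1 c2]) (use c_tilde_diff in blast)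
  moreover have "1 - (1 / 8 - \<alpha> * \<beta> / 2) / \<gamma> - (1 / 8 - \<alpha> * \<beta> / 2) / \<gamma> = (\<gamma> - 1 / 4 + \<alpha> * \<beta>) / \<gamma>"
    using pos by (simp add: field_simps)
  ultimately have c3: "has_natural_density {n. n \<ge> 1 \<and> ?c n = 0} ((\<gamma> - 1 / 4 + \<alpha> * \<beta>) / \<gamma>)"
    by simp
  from b1 b2 b3 c1 c2 c3 show ?thesis by blast
qed

end
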